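(* Let $W_{n,d}$ denote the maximum Wiener index of a graph of order $n$ and diameter $d$. Then $$\liminf_{d\to\infty}\ \liminf_{n\to\infty}\ \frac{\frac d2 n^2 - W_{n,d}}{d^{3/2}n^{3/2}}\ \ge\ \frac{1}{2\sqrt{24}}>0.1$$ and $$\limsup_{d\to\infty}\ \limsup_{n\to\infty}\ \frac{\frac d2 n^2 - W_{n,d}}{d^{3/2}n^{3/2}}\ <\ \frac{29}{60}.$$
   Context: Graphs are finite, simple and undirected. The Wiener index is $W(G)=\sum_{\{u,v\}\subset V(G)} d(u,v)$ over unordered pairs of distinct vertices, where $d(u,v)$ is graph distance; the diameter is the maximum distance. *)

theory Defs
  imports
    "HOL-Analysis.Analysis"
    "Graph_Theory.Graph_Theory"
begin

text \<open>
  A finite simple undirected graph is a \<open>pair_graph\<close>: a finite vertex set with a symmetric,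
  irreflexive arc relation, every edge being represented by two opposite arcs.
\<close>

text \<open>The distance is \<open>\<infinity>\<close> between vertices in different components.\<close>

definition gdist :: "'a pair_pre_digraph \<Rightarrow> 'a \<Rightarrow> 'a \<Rightarrow> ereal" where
  "gdist G u v = wf_digraph.\<mu> (with_proj G) (\<lambda>_. 1) u v"

definition graph_diameter :: "'a pair_pre_digraph \<Rightarrow> ereal" where
  "graph_diameter G = (SUP u\<in>pverts G. SUP v\<in>pverts G. gdist G u v)"

text \<open>The condition \<open>u < v\<close> selects each unordered pair of distinct vertices exactly once.\<close>

definition wiener_index :: "'a::linorder pair_pre_digraph \<Rightarrow> ereal" where
  "wiener_index G = (\<Sum>(u, v)\<in>{(u, v). u \<in> pverts G \<and> v \<in> pverts G \<and> u < v}. gdist G u v)"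

definition wiener_values :: "nat \<Rightarrow> nat \<Rightarrow> ereal set" where
  "wiener_values n d =
     {wiener_index G | G :: nat pair_pre_digraph.
        pair_graph G \<and> card (pverts G) = n \<and> graph_diameter G = ereal (real d)}"

text \<open>
  Every finite graph is isomorphic to one with vertices in \<^typ>\<open>nat\<close>.  A graph of finite
  diameter is connected.  The set of values is finite (\<open>finite_wiener_values\<close> below), and it is
  nonempty whenever \<open>1 \<le> d < n\<close>, so the maximum is a genuine one in that range; the
  unspecified value in the other cases affects only finitely many \<open>n\<close> for each \<open>d \<ge> 1\<close>.
\<close>

definition max_wiener :: "nat \<Rightarrow> nat \<Rightarrow> ereal" where
  "max_wiener n d = Max (wiener_values n d)"

definition wiener_deficit_ratio :: "nat \<Rightarrow> nat \<Rightarrow> ereal" where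
  "wiener_deficit_ratio n d =
     (ereal (real d / 2 * real n ^ 2) - max_wiener n d)
       / ereal (real d powr (3/2) * real n powr (3/2))"

lemma gdist_eq:
  assumes "pair_graph G"
  shows "gdist G u v =
    (INF p\<in>{p. pre_digraph.awalk (with_proj G) u p v}. ereal (real (length p)))"
proof -
  interpret pair_graph G by fact
  have "awalk_cost (\<lambda>_. 1) p = real (length p)" for p :: "('a \<times> 'a) list"
    by (induction p) auto
  then show ?thesis
    unfolding gdist_def \<mu>_def by simp
qed

lemma gdist_nat:
  assumes "pair_graph G" "gdist G u v \<le> ereal (real d)"
  shows "\<exists>k\<le>d. gdist G u v = ereal (real k)"
proof -
  define L where "L = length ` {p. pre_digraph.awalk (with_proj G) u p v}"
  have eq: "gdist G u v = (INF k\<in>L. ereal (real k))"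
    unfolding gdist_eq[OF assms(1)] L_def by (simp add: image_image)
  have "L \<noteq> {}"
    using assms(2) eq by (auto simp: top_ereal_def)
  define m where "m = (LEAST k. k \<in> L)"
  have "m \<in> L" using \<open>L \<noteq> {}\<close> unfolding m_def by (metis LeastI ex_in_conv)
  have "m \<le> k" if "k \<in> L" for k using that unfolding m_def by (rule Least_le)
  then have "(INF k\<in>L. ereal (real k)) = ereal (real m)"
    using \<open>m \<in> L\<close> by (intro INF_eqI) auto
  with eq assms(2) show ?thesis by auto
qed

lemma finite_wiener_values: "finite (wiener_values n d)"
proof (rule finite_subset)
  show "wiener_values n d \<subseteq> (\<lambda>k. ereal (real k)) ` {..n * n * d}"
  proof
    fix w assume "w \<in> wiener_values n d"
    then obtain G :: "nat pair_pre_digraph" where G: "pair_graph G" "card (pverts G) = n"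
        "graph_diameter G = ereal (real d)" "w = wiener_index G"
      unfolding wiener_values_def by blast
    interpret pair_graph G by fact
    define P where "P = {(u, v). u \<in> pverts G \<and> v \<in> pverts G \<and> u < v}"
    have P: "P \<subseteq> pverts G \<times> pverts G" unfolding P_def by auto
    have fin: "finite (pverts G \<times> pverts G)" using pair_finite_verts by simp
    have "card P \<le> n * n"
      using card_mono[OF fin P] G(2) by (simp add: card_cartesian_product)
    have "\<exists>k\<le>d. gdist G u v = ereal (real k)" if "u \<in> pverts G" "v \<in> pverts G" for u v
    proof (rule gdist_nat[OF G(1)])
      show "gdist G u v \<le> ereal (real d)"
        using that unfolding G(3)[symmetric] graph_diameter_def
        by (meson SUP_upper2 order_refl)
    qed
    then obtain f where f: "\<And>u v. u \<in> pverts G \<Longrightarrow> v \<in> pverts G \<Longrightarrow>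
        f u v \<le> d \<and> gdist G u v = ereal (real (f u v))"
      by metis
    have "w = (\<Sum>(u,v)\<in>P. ereal (real (f u v)))"
      unfolding G(4) wiener_index_def P_def[symmetric]
      by (rule sum.cong) (use f P in auto)
    also have "\<dots> = ereal (real (\<Sum>(u,v)\<in>P. f u v))"
      by (simp add: case_prod_unfold)
    finally have w: "w = ereal (real (\<Sum>(u,v)\<in>P. f u v))" .
    have "(\<Sum>(u,v)\<in>P. f u v) \<le> card P * d"
      using sum_bounded_above[of P "\<lambda>(u,v). f u v" d] f P by fastforce
    also have "\<dots> \<le> n * n * d" using \<open>card P \<le> n * n\<close> by simp
    finally show "w \<in> (\<lambda>k. ereal (real k)) ` {..n * n * d}" using w by blast
  qed
qed simp

end

theory Submission
  imports Defs "HOL-Real_Asymp.Real_Asymp"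
begin

text \<open>
  Write \<open>S\<close> for the sum of \<open>d - d(u,v)\<close> over all ordered pairs of vertices, including \<open>u = v\<close>; the
  numerator of the ratio is exactly \<open>S / 2\<close>.

  Lower bound: some vertex \<open>v\<close> satisfies \<open>\<Sum>\<^sub>u (d - d(u,v)) \<le> S / n\<close>. Let \<open>b\<^sub>j\<close> be the number of vertices
  at distance \<open>d - j\<close> from \<open>v\<close>, so that \<open>\<Sum> j b\<^sub>j \<le> S / n\<close> and \<open>b\<^sub>0\<close> is almost \<open>n\<close>. Grouping the last
  layer by ancestors in the layer \<open>d - j\<close> yields at least \<open>b\<^sub>0\<^sup>2 / b\<^sub>j\<close> ordered pairs at distance at most
  \<open>2 j\<close>, whence \<open>S \<ge> \<Sum> 2 b\<^sub>0\<^sup>2 / b\<^sub>j\<close> over \<open>1 \<le> j < d / 2\<close>, and Cauchy--Schwarz bounds \<open>S\<^sup>2\<close> from below.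

  Upper bound: take about \<open>sqrt (3 n / d)\<close> paths of length \<open>d / 2\<close> from a common centre, let each of
  them fork into two at distance \<open>d / 3\<close> from the centre, and spread the remaining vertices evenly
  as twins over the ends. The limiting constant is \<open>5 sqrt 3 / 18 < 0.482 < 29 / 60\<close>.
\<close>

section \<open>Distances in graphs of finite diameter\<close>

lemma gdist_le_awalk:
  assumes "pair_graph G" "pre_digraph.awalk (with_proj G) u p v"
  shows "gdist G u v \<le> ereal (real (length p))"
  unfolding gdist_eq[OF assms(1)] using assms(2) by (intro INF_lower) auto

text \<open>Walk lengths are natural numbers, so the infimum that defines the distance is attained
  as soon as some walk exists; a finite value rules out the empty set of walks, whose infimum is
  \<infinity>.\<close>

lemma gdist_geodesic:
  assumes G: "pair_graph G" and fin: "gdist G u v = ereal (real k)"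
  obtains p where "pre_digraph.awalk (with_proj G) u p v" "length p = k"
proof -
  define P where "P = {p. pre_digraph.awalk (with_proj G) u p v}"
  have eq: "gdist G u v = (INF p\<in>P. ereal (real (length p)))"
    unfolding gdist_eq[OF G] P_def ..
  have "P \<noteq> {}"
    using fin eq by (auto simp: top_ereal_def)
  then obtain p0 where "p0 \<in> P" by blast
  then obtain p where p: "p \<in> P" "\<And>q. q \<in> P \<Longrightarrow> length p \<le> length q"
    using ex_has_least_nat[of "\<lambda>p. p \<in> P" p0 length] by blast
  have "(INF p\<in>P. ereal (real (length p))) = ereal (real (length p))"
    using p by (intro INF_eqI) auto
  with eq fin have "length p = k" by simp
  with p that show ?thesis unfolding P_def by blast
qed

lemma gdist_le_graph_diameter:
  assumes "u \<in> pverts G" "v \<in> pverts G"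
  shows "gdist G u v \<le> graph_diameter G"
  using assms unfolding graph_diameter_def by (meson SUP_upper2 order_refl)

text \<open>The only interface through which graphs are used later: a natural-valued metric in which
  every distance can be split at any intermediate value. The splitting point is the vertex reached
  after \<open>k\<close> arcs of a geodesic.\<close>

lemma finite_diameter_metric:
  assumes G: "pair_graph G" and d: "graph_diameter G = ereal (real d)"
  obtains f :: "'a \<Rightarrow> 'a \<Rightarrow> nat" where
    "\<And>u v. u \<in> pverts G \<Longrightarrow> v \<in> pverts G \<Longrightarrow> gdist G u v = ereal (real (f u v))"
    "\<And>u v. u \<in> pverts G \<Longrightarrow> v \<in> pverts G \<Longrightarrow> f u v \<le> d"
    "\<And>u. u \<in> pverts G \<Longrightarrow> f u u = 0"
    "\<And>u v. u \<in> pverts G \<Longrightarrow> v \<in> pverts G \<Longrightarrow> f u v = f v u"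
    "\<And>u v w. u \<in> pverts G \<Longrightarrow> v \<in> pverts G \<Longrightarrow> w \<in> pverts G \<Longrightarrow> f u w \<le> f u v + f v w"
    "\<And>u v k. u \<in> pverts G \<Longrightarrow> v \<in> pverts G \<Longrightarrow> k \<le> f u v \<Longrightarrow>
       \<exists>w\<in>pverts G. f u w = k \<and> f w v = f u v - k"
proof -
  interpret pair_graph G by fact
  have "\<exists>k\<le>d. gdist G u v = ereal (real k)" if "u \<in> pverts G" "v \<in> pverts G" for u v
    using gdist_nat[OF G] gdist_le_graph_diameter[OF that] d by metis
  then obtain f where f: "\<And>u v. u \<in> pverts G \<Longrightarrow> v \<in> pverts G \<Longrightarrow>
      f u v \<le> d \<and> gdist G u v = ereal (real (f u v))"
    by metis
  have le: "f u v \<le> length p" if "awalk u p v" for u v p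
  proof -
    have "u \<in> pverts G" "v \<in> pverts G" using that by auto
    then show ?thesis using gdist_le_awalk[OF G that] f by auto
  qed
  have geo: "\<exists>p. awalk u p v \<and> length p = f u v" if "u \<in> pverts G" "v \<in> pverts G" for u v
    using gdist_geodesic[OF G] f that by metis
  have refl: "f u u = 0" if "u \<in> pverts G" for u
    using le[of u "[]" u] that by (simp add: awalk_Nil_iff)
  have le_sym: "f u v \<le> f v u" if uv: "u \<in> pverts G" "v \<in> pverts G" for u v
  proof -
    obtain p where p: "awalk v p u" "length p = f v u" using geo uv by blast
    have "length (rev_path q) = length q" for q :: "('a \<times> 'a) list" by (induction q) auto
    with p le[of u "rev_path p" v] show ?thesis by (simp add: awalk_rev_path)
  qed
  have tri: "f u w \<le> f u v + f v w"
    if uvw: "u \<in> pverts G" "v \<in> pverts G" "w \<in> pverts G" for u v w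
  proof -
    obtain p q where "awalk u p v" "length p = f u v" "awalk v q w" "length q = f v w"
      using geo uvw by metis
    with le[of u "p @ q" w] show ?thesis by (metis awalk_appendI length_append)
  qed
  have inter: "\<exists>w\<in>pverts G. f u w = k \<and> f w v = f u v - k"
    if uv: "u \<in> pverts G" "v \<in> pverts G" and k: "k \<le> f u v" for u v k
  proof -
    obtain p where p: "awalk u p v" "length p = f u v" using geo uv by blast
    then have "awalk u (take k p @ drop k p) v" by simp
    then obtain w where w: "awalk u (take k p) w" "awalk w (drop k p) v"
      by (metis awalk_append_iff)
    then have wV: "w \<in> pverts G" by auto
    have "f u w \<le> k" "f w v \<le> f u v - k"
      using le[OF w(1)] le[OF w(2)] p(2) k by auto
    \<comment> \<open>The two pieces have total length exactly \<open>f u v\<close>, so the triangle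
      inequality turns both upper bounds into equalities.\<close>
    moreover have "f u v \<le> f u w + f w v" using tri uv wV by simp
    ultimately show ?thesis using wV k by (intro bexI[of _ w]) auto
  qed
  show thesis
    by (rule that[of f]) (use f refl le_sym tri inter in \<open>auto intro: antisym\<close>)
qed

lemma wiener_index_eq_half_sum:
  fixes G :: "'a::linorder pair_pre_digraph"
  assumes fin: "finite (pverts G)"
    and f: "\<And>u v. u \<in> pverts G \<Longrightarrow> v \<in> pverts G \<Longrightarrow> gdist G u v = ereal (f u v)"
    and refl: "\<And>u. u \<in> pverts G \<Longrightarrow> f u u = 0"
    and sym: "\<And>u v. u \<in> pverts G \<Longrightarrow> v \<in> pverts G \<Longrightarrow> f u v = f v u"
  shows "wiener_index G = ereal ((\<Sum>u\<in>pverts G. \<Sum>v\<in>pverts G. f u v) / 2)"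
proof -
  let ?V = "pverts G"
  define P where "P = {(u, v). u \<in> ?V \<and> v \<in> ?V \<and> u < v}"
  define Q where "Q = {(u, v). u \<in> ?V \<and> v \<in> ?V \<and> v < u}"
  have sub: "P \<subseteq> ?V \<times> ?V" "Q \<subseteq> ?V \<times> ?V" unfolding P_def Q_def by auto
  then have finPQ: "finite P" "finite Q" using fin by (meson finite_SigmaI finite_subset)+
  have "wiener_index G = (\<Sum>(u,v)\<in>P. ereal (f u v))"
    unfolding wiener_index_def P_def[symmetric]
    by (rule sum.cong) (use f sub in auto)
  also have "\<dots> = ereal (\<Sum>(u,v)\<in>P. f u v)"
    by (simp add: case_prod_unfold)
  finally have W: "wiener_index G = ereal (\<Sum>(u,v)\<in>P. f u v)" .
  have "(\<Sum>(u,v)\<in>P. f u v) = (\<Sum>(u,v)\<in>Q. f u v)"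
    by (rule sum.reindex_bij_witness[of _ prod.swap prod.swap])
       (auto simp: P_def Q_def intro: sym)
  moreover have "(\<Sum>(u,v)\<in>?V \<times> ?V. f u v) = (\<Sum>(u,v)\<in>P \<union> Q. f u v)"
  proof (rule sum.mono_neutral_right)
    show "\<forall>i\<in>?V \<times> ?V - (P \<union> Q). (case i of (u, v) \<Rightarrow> f u v) = 0"
    proof
      fix i assume i: "i \<in> ?V \<times> ?V - (P \<union> Q)"
      then have "fst i = snd i" by (cases i) (auto simp: P_def Q_def)
      with i refl show "(case i of (u, v) \<Rightarrow> f u v) = 0" by (cases i) auto
    qed
  qed (use fin sub in auto)
  moreover have "\<dots> = (\<Sum>(u,v)\<in>P. f u v) + (\<Sum>(u,v)\<in>Q. f u v)"
    by (rule sum.union_disjoint) (use finPQ in \<open>auto simp: P_def Q_def\<close>)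
  ultimately show ?thesis unfolding W by (simp add: sum.cartesian_product)
qed

section \<open>The lower bound on the deficit\<close>

text \<open>The pairs with equal image number the sum of the squared fibre sizes; Cauchy--Schwarz
  against the constant 1 bounds this from below by \<open>card X\<close> squared over the number of
  available values.\<close>

lemma sum_card_fibres_sq:
  assumes "finite X" "finite Y" "c ` X \<subseteq> Y" "Y \<noteq> {}"
  shows "real (card X) ^ 2 / real (card Y) \<le> real (card {(x, y). x \<in> X \<and> y \<in> X \<and> c x = c y})"
proof -
  define F where "F w = {x \<in> X. c x = w}" for w
  have finF: "finite (F w)" for w using assms unfolding F_def by auto
  have X: "X = (\<Union>w\<in>Y. F w)" using assms unfolding F_def by auto
  have cX: "card X = (\<Sum>w\<in>Y. card (F w))"
    by (subst X, rule card_UN_disjoint) (use assms finF in \<open>auto simp: F_def\<close>)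
  have R: "{(x, y). x \<in> X \<and> y \<in> X \<and> c x = c y} = (\<Union>w\<in>Y. F w \<times> F w)"
    using assms unfolding F_def by auto
  have "card {(x, y). x \<in> X \<and> y \<in> X \<and> c x = c y} = (\<Sum>w\<in>Y. card (F w) * card (F w))"
    unfolding R by (subst card_UN_disjoint)
      (use assms finF in \<open>auto simp: F_def card_cartesian_product\<close>)
  then have "real (card {(x, y). x \<in> X \<and> y \<in> X \<and> c x = c y}) = (\<Sum>w\<in>Y. real (card (F w)) ^ 2)"
    by (simp add: power2_eq_square)
  moreover have "(\<Sum>w\<in>Y. real (card (F w)) * 1)\<^sup>2 \<le> (\<Sum>w\<in>Y. real (card (F w)) ^ 2) * (\<Sum>w\<in>Y. 1\<^sup>2)"
    by (rule Cauchy_Schwarz_ineq_sum)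
  ultimately show ?thesis using assms cX by (simp add: field_simps card_gt_0_iff)
qed

text \<open>A layer-cake bound that lets the deficit be summed over thresholds: each
  \<open>2 * j\<close> between \<open>t\<close> and \<open>2 * m\<close> accounts for two units of
  \<open>d - t\<close>. The slack in \<open>2 * m + 2 \<le> d\<close> pays for counting both ends of
  the range of \<open>j\<close>.\<close>

lemma deficit_ge_count:
  fixes t d m :: nat
  assumes "2 * m + 2 \<le> d" "t \<le> d"
  shows "(\<Sum>j\<in>{1..m}. if t \<le> 2 * j then 2 else 0) \<le> real d - real t"
proof -
  have "card {j \<in> {1..m}. t \<le> 2 * j} \<le> card {(t + 1) div 2..m}"
    by (rule card_mono) auto
  moreover have "(\<Sum>j\<in>{1..m}. if t \<le> 2 * j then 2 else 0) = 2 * real (card {j \<in> {1..m}. t \<le> 2 * j})"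
    by (simp add: sum.If_cases Int_def)
  moreover have "2 * (m + 1 - (t + 1) div 2) \<le> d - t" using assms by linarith
  ultimately show ?thesis using assms by (simp add: of_nat_diff)
qed

text \<open>With \<open>b j\<close> the size of the layer at distance \<open>d - j\<close> from a
  well-chosen vertex, two estimates are multiplied. Averaging gives
  \<open>\<Sum> j * b j \<le> S / n\<close>, and common ancestors give
  \<open>\<Sum> 2 * (b 0)\<^sup>2 / b j \<le> S\<close>. Cauchy--Schwarz eliminates the unknown
  layer sizes except for \<open>b 0\<close>, which is at least \<open>n - S / n\<close>.\<close>

lemma metric_deficit_sq_ge:
  fixes f :: "'a \<Rightarrow> 'a \<Rightarrow> nat"
  assumes fin: "finite V" and ne: "V \<noteq> {}"
    and fd: "\<And>u v. u \<in> V \<Longrightarrow> v \<in> V \<Longrightarrow> f u v \<le> d"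
    and sym: "\<And>u v. u \<in> V \<Longrightarrow> v \<in> V \<Longrightarrow> f u v = f v u"
    and tri: "\<And>u v w. u \<in> V \<Longrightarrow> v \<in> V \<Longrightarrow> w \<in> V \<Longrightarrow> f u w \<le> f u v + f v w"
    and inter: "\<And>u v k. u \<in> V \<Longrightarrow> v \<in> V \<Longrightarrow> k \<le> f u v \<Longrightarrow>
       \<exists>w\<in>V. f u w = k \<and> f w v = f u v - k"
    and m: "2 * m + 2 \<le> d" "m > 0"
    and S: "S = (\<Sum>u\<in>V. \<Sum>v\<in>V. real d - real (f u v))"
    and n: "n = real (card V)" and small: "S < n\<^sup>2"
  shows "S\<^sup>2 \<ge> n * (n - S / n)\<^sup>2 * (real m * (real m + 1)\<^sup>2 / 2)"
proof -
  have n0: "n > 0" using n fin ne by (simp add: card_gt_0_iff)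
  define l where "l v = (\<Sum>u\<in>V. real d - real (f v u))" for v
  \<comment> \<open>Some vertex is at most average: if every \<open>l v\<close> exceeded
    \<open>S / n\<close>, their sum would exceed \<open>S\<close>.\<close>
  obtain v0 where v0: "v0 \<in> V" "l v0 \<le> S / n"
  proof (rule ccontr)
    assume "\<not> thesis"
    then have "\<forall>v\<in>V. S / n < l v" using that by force
    then have "(\<Sum>v\<in>V. S / n) < (\<Sum>v\<in>V. l v)" using fin ne by (intro sum_strict_mono) auto
    then show False using n n0 unfolding S l_def by simp
  qed
  define L where "L j = {u \<in> V. f v0 u = d - j}" for j
  define b where "b j = real (card (L j))" for j
  have finL: "finite (L j)" for j using fin unfolding L_def by auto
  \<comment> \<open>Each vertex lies in at most one layer, and its index there is its deficit from
    \<open>v0\<close>.\<close>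
  have lower: "(\<Sum>j\<in>{1..m}. if f v0 u = d - j then real j else 0) \<le> real d - real (f v0 u)"
    if "u \<in> V" for u
  proof -
    have "(\<Sum>j\<in>{1..m}. if f v0 u = d - j then real j else 0) 
        = (\<Sum>j\<in>{1..m}. if d - f v0 u = j then real j else 0)"
      by (rule sum.cong) (use m fd[OF v0(1) that] in auto)
    also have "\<dots> \<le> real (d - f v0 u)" by simp
    finally show ?thesis using fd[OF v0(1) that] by simp
  qed
  have bX: "(\<Sum>j\<in>{1..m}. real j * b j) \<le> S / n"
  proof -
    have "(\<Sum>j\<in>{1..m}. real j * b j)
        = (\<Sum>j\<in>{1..m}. \<Sum>u\<in>V. if f v0 u = d - j then real j else 0)"
      unfolding b_def L_def using fin by (simp add: sum.If_cases Int_def mult.commute)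
    also have "\<dots> = (\<Sum>u\<in>V. \<Sum>j\<in>{1..m}. if f v0 u = d - j then real j else 0)"
      by (rule sum.swap)
    also have "\<dots> \<le> l v0" unfolding l_def by (rule sum_mono) (use lower in auto)
    finally show ?thesis using v0 by simp
  qed
  \<comment> \<open>Every vertex outside the last layer has deficit at least 1 from
    \<open>v0\<close>, so there are at most \<open>l v0\<close> of them.\<close>
  have b0: "n - S / n \<le> b 0"
  proof -
    have "n - b 0 = real (card (V - L 0))"
      unfolding n b_def using fin finL by (subst card_Diff_subset)
        (auto simp: L_def intro!: of_nat_diff[symmetric] card_mono)
    also have "\<dots> = (\<Sum>u\<in>V - L 0. 1)" by simp
    also have "\<dots> \<le> (\<Sum>u\<in>V - L 0. real d - real (f v0 u))"
    proof (rule sum_mono)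
      fix u assume "u \<in> V - L 0"
      then have "f v0 u < d" using fd[OF v0(1), of u] by (auto simp: L_def)
      then show "1 \<le> real d - real (f v0 u)" by simp
    qed
    also have "\<dots> \<le> l v0" unfolding l_def
      by (rule sum_mono2) (use fin fd[OF v0(1)] in auto)
    finally show ?thesis using v0 by simp
  qed
  have pos: "n - S / n > 0" using small n0 by (simp add: field_simps power2_eq_square)
  \<comment> \<open>The ancestor of \<open>x\<close> is the point at distance \<open>d - j\<close>
    from \<open>v0\<close> on a geodesic to \<open>x\<close>. Since the last layer is nonempty, this
    also shows that no layer \<open>L j\<close> is empty, which makes the later divisions by
    \<open>b j\<close> meaningful.\<close>
  have anc: "\<exists>w\<in>L j. f w x = j" if "x \<in> L 0" "j \<in> {1..m}" for x j
  proof -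
    have x: "x \<in> V" "f v0 x = d" using that by (auto simp: L_def)
    obtain w where "w \<in> V" "f v0 w = d - j" "f w x = f v0 x - (d - j)"
      using inter[OF v0(1) x(1), of "d - j"] x(2) by auto
    then show ?thesis using x that m by (intro bexI[of _ w]) (auto simp: L_def)
  qed
  have b_pos: "b j > 0" if "j \<in> {1..m}" for j
  proof -
    have "b 0 > 0" using b0 pos by linarith
    then obtain x where "x \<in> L 0" unfolding b_def by (auto simp: card_gt_0_iff)
    from anc[OF this that] show ?thesis unfolding b_def using finL by (auto simp: card_gt_0_iff)
  qed
  define N where "N t = real (card {(x, y). x \<in> V \<and> y \<in> V \<and> f x y \<le> t})" for t
  have N: "(b 0)\<^sup>2 / b j \<le> N (2 * j)" if j: "j \<in> {1..m}" for j
  proof -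
    obtain c where c: "\<And>x. x \<in> L 0 \<Longrightarrow> c x \<in> L j \<and> f (c x) x = j"
      using anc[OF _ j] by metis
    have "L j \<noteq> {}" using b_pos[OF j] by (auto simp: b_def)
    then have "(b 0)\<^sup>2 / b j \<le> real (card {(x, y). x \<in> L 0 \<and> y \<in> L 0 \<and> c x = c y})"
      unfolding b_def using c finL by (intro sum_card_fibres_sq) auto
    also have "\<dots> \<le> N (2 * j)"
    proof -
      have "f x y \<le> 2 * j" if "x \<in> L 0" "y \<in> L 0" "c x = c y" for x y
      proof -
        have V: "x \<in> V" "y \<in> V" "c x \<in> V" using that c by (auto simp: L_def)
        have "f x y \<le> f x (c x) + f (c x) y" using tri V by simp
        then show ?thesis using c that sym V by (metis mult_2)
      qed
      then have "{(x, y). x \<in> L 0 \<and> y \<in> L 0 \<and> c x = c y} \<subseteq> {(x, y). x \<in> V \<and> y \<in> V \<and> f x y \<le> 2 * j}"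
        by (auto simp: L_def)
      moreover have "finite {(x, y). x \<in> V \<and> y \<in> V \<and> f x y \<le> 2 * j}"
        by (rule finite_subset[of _ "V \<times> V"]) (use fin in auto)
      ultimately show ?thesis unfolding N_def by (simp add: card_mono)
    qed
    finally show ?thesis .
  qed
  have SN: "(\<Sum>j\<in>{1..m}. 2 * N (2 * j)) \<le> S"
  proof -
    have "2 * N t = (\<Sum>u\<in>V. \<Sum>v\<in>V. if f u v \<le> t then 2 else 0)" for t
    proof -
      have "(\<Sum>u\<in>V. \<Sum>v\<in>V. if f u v \<le> t then 2 else 0) = (\<Sum>p\<in>V \<times> V. if f (fst p) (snd p) \<le> t then 2 else (0::real))"
        by (simp add: sum.cartesian_product case_prod_unfold)
      also have "\<dots> = 2 * real (card {p \<in> V \<times> V. f (fst p) (snd p) \<le> t})"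
        using fin by (simp add: sum.If_cases Int_def)
      also have "{p \<in> V \<times> V. f (fst p) (snd p) \<le> t} = {(x, y). x \<in> V \<and> y \<in> V \<and> f x y \<le> t}"
        by auto
      finally show ?thesis by (simp add: N_def)
    qed
    then have "(\<Sum>j\<in>{1..m}. 2 * N (2 * j))
        = (\<Sum>j\<in>{1..m}. \<Sum>u\<in>V. \<Sum>v\<in>V. if f u v \<le> 2 * j then 2 else 0)" by simp
    also have "\<dots> = (\<Sum>u\<in>V. \<Sum>v\<in>V. \<Sum>j\<in>{1..m}. if f u v \<le> 2 * j then 2 else 0)"
      by (subst sum.swap, rule sum.cong[OF refl], rule sum.swap)
    also have "\<dots> \<le> S" unfolding S
      by (intro sum_mono deficit_ge_count m(1) fd)
    finally show ?thesis .
  qed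
  \<comment> \<open>The extra weight \<open>j\<close>, bounded by \<open>m\<close> in the next
    estimate, makes the Cauchy--Schwarz products equal to \<open>j\<close> instead of
    \<open>sqrt j\<close>. The loss is affordable: with \<open>m\<close> near \<open>d / 2\<close>
    and \<open>b 0\<close> near \<open>n\<close> the bound on \<open>S\<^sup>2\<close> is about
    \<open>d^3 * n^3 / 16\<close>, against the target \<open>d^3 * n^3 / 24\<close>.\<close>
  define Y where "Y = (\<Sum>j\<in>{1..m}. real j / b j)"
  have "2 * (b 0)\<^sup>2 * Y \<le> real m * S"
  proof -
    have "2 * (b 0)\<^sup>2 * Y = (\<Sum>j\<in>{1..m}. real j * (2 * ((b 0)\<^sup>2 / b j)))"
      unfolding Y_def sum_distrib_left by (simp add: field_simps)
    also have "\<dots> \<le> (\<Sum>j\<in>{1..m}. real m * (2 * N (2 * j)))"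
    proof (rule sum_mono, rule mult_mono)
      fix j assume j: "j \<in> {1..m}"
      show "2 * ((b 0)\<^sup>2 / b j) \<le> 2 * N (2 * j)" using N[OF j] by simp
      show "0 \<le> 2 * ((b 0)\<^sup>2 / b j)" by (simp add: b_def)
    qed auto
    also have "\<dots> \<le> real m * S"
      using SN by (simp add: sum_distrib_left[symmetric] mult_left_mono)
    finally show ?thesis .
  qed
  moreover have "(real m * (real m + 1) / 2)\<^sup>2 \<le> S / n * Y"
  proof -
    \<comment> \<open>The factors are chosen so that \<open>b j\<close> cancels in each product,
      leaving the sum of the first \<open>m\<close> integers.\<close>
    have "(\<Sum>j\<in>{1..m}. sqrt (real j * b j) * sqrt (real j / b j))\<^sup>2
        \<le> (\<Sum>j\<in>{1..m}. (sqrt (real j * b j))\<^sup>2) * (\<Sum>j\<in>{1..m}. (sqrt (real j / b j))\<^sup>2)"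
      by (rule Cauchy_Schwarz_ineq_sum)
    moreover have "(\<Sum>j\<in>{1..m}. sqrt (real j * b j) * sqrt (real j / b j)) = real m * (real m + 1) / 2"
    proof -
      have "(\<Sum>j\<in>{1..m}. sqrt (real j * b j) * sqrt (real j / b j)) = (\<Sum>j\<in>{1..m}. real j)"
      proof (rule sum.cong)
        fix j assume "j \<in> {1..m}"
        from b_pos[OF this] have "real j * b j * (real j / b j) = (real j)\<^sup>2"
          by (simp add: power2_eq_square)
        then show "sqrt (real j * b j) * sqrt (real j / b j) = real j"
          by (simp add: real_sqrt_mult[symmetric])
      qed simp
      also have "\<dots> = real m * (real m + 1) / 2"
        by (induction m) (auto simp: field_simps)
      finally show ?thesis .
    qed
    moreover have "(\<Sum>j\<in>{1..m}. (sqrt (real j * b j))\<^sup>2) = (\<Sum>j\<in>{1..m}. real j * b j)"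
      by (rule sum.cong) (use b_pos in \<open>auto simp: b_def\<close>)
    moreover have "(\<Sum>j\<in>{1..m}. (sqrt (real j / b j))\<^sup>2) = Y" unfolding Y_def
      by (rule sum.cong) (use b_pos in \<open>auto simp: b_def\<close>)
    ultimately have "(real m * (real m + 1) / 2)\<^sup>2 \<le> (\<Sum>j\<in>{1..m}. real j * b j) * Y" by (simp only:)
    also have "\<dots> \<le> S / n * Y"
      by (rule mult_right_mono[OF bX]) (auto simp: Y_def b_def intro!: sum_nonneg)
    finally show ?thesis .
  qed
  moreover have "S \<ge> 0" unfolding S by (intro sum_nonneg) (use fd in auto)
  ultimately have "2 * (b 0)\<^sup>2 * (real m * (real m + 1) / 2)\<^sup>2 \<le> S / n * (real m * S)"
  proof -
    assume A: "2 * (b 0)\<^sup>2 * Y \<le> real m * S" and B: "(real m * (real m + 1) / 2)\<^sup>2 \<le> S / n * Y"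
      and "S \<ge> 0"
    have "2 * (b 0)\<^sup>2 * (real m * (real m + 1) / 2)\<^sup>2 \<le> 2 * (b 0)\<^sup>2 * (S / n * Y)"
      by (rule mult_left_mono[OF B]) auto
    also have "\<dots> = S / n * (2 * (b 0)\<^sup>2 * Y)" by simp
    also have "\<dots> \<le> S / n * (real m * S)"
      by (rule mult_left_mono[OF A]) (use \<open>S \<ge> 0\<close> n0 in auto)
    finally show ?thesis .
  qed
  then have "real m * (n * (b 0)\<^sup>2 * (real m * (real m + 1)\<^sup>2 / 2)) \<le> real m * S\<^sup>2"
    using n0 by (simp add: field_simps power2_eq_square)
  then have "n * (b 0)\<^sup>2 * (real m * (real m + 1)\<^sup>2 / 2) \<le> S\<^sup>2" using m(2) by simp
  moreover have "(n - S / n)\<^sup>2 \<le> (b 0)\<^sup>2" using b0 pos by (intro power_mono) auto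
  then have "n * (n - S / n)\<^sup>2 * (real m * (real m + 1)\<^sup>2 / 2) 
      \<le> n * (b 0)\<^sup>2 * (real m * (real m + 1)\<^sup>2 / 2)"
    using n0 by (intro mult_right_mono mult_left_mono) auto
  ultimately show ?thesis by linarith
qed

lemma powr_three_halves: "x \<ge> 0 \<Longrightarrow> x powr (3/2) = sqrt (x ^ 3)" for x :: real
  using powr_powr[of x 3 "1/2"] by (simp add: powr_half_sqrt)

text \<open>By contradiction: a deficit below the target \<open>T\<close> is below
  \<open>n\<^sup>2 / 10\<close>, because \<open>n\<close> is large compared with \<open>d^3\<close>.
  Then at least nine tenths of the vertices lie in the last layer, and the squared bound already
  exceeds \<open>T\<^sup>2\<close>.\<close>

lemma metric_deficit_ge:
  fixes f :: "'a \<Rightarrow> 'a \<Rightarrow> nat"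
  assumes fin: "finite V"
    and fd: "\<And>u v. u \<in> V \<Longrightarrow> v \<in> V \<Longrightarrow> f u v \<le> d"
    and sym: "\<And>u v. u \<in> V \<Longrightarrow> v \<in> V \<Longrightarrow> f u v = f v u"
    and tri: "\<And>u v w. u \<in> V \<Longrightarrow> v \<in> V \<Longrightarrow> w \<in> V \<Longrightarrow> f u w \<le> f u v + f v w"
    and inter: "\<And>u v k. u \<in> V \<Longrightarrow> v \<in> V \<Longrightarrow> k \<le> f u v \<Longrightarrow>
       \<exists>w\<in>V. f u w = k \<and> f w v = f u v - k"
    and d: "d \<ge> 100" and n: "real (card V) \<ge> 5 * real d ^ 3"
  shows "sqrt (real d ^ 3) * sqrt (real (card V) ^ 3) / sqrt 24
    \<le> (\<Sum>u\<in>V. \<Sum>v\<in>V. real d - real (f u v))"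
proof (rule ccontr)
  define S where "S = (\<Sum>u\<in>V. \<Sum>v\<in>V. real d - real (f u v))"
  define n where "n = real (card V)"
  define T where "T = sqrt (real d ^ 3) * sqrt (n ^ 3) / sqrt 24"
  assume "\<not> ?thesis"
  then have ST: "S < T" unfolding S_def T_def n_def by simp
  have nd: "n \<ge> 5 * real d ^ 3" using n n_def by simp
  have n0: "n > 0" using nd d by (intro less_le_trans[OF _ nd]) simp
  have S0: "S \<ge> 0" unfolding S_def by (intro sum_nonneg) (use fd in auto)
  have T2: "T\<^sup>2 = real d ^ 3 * n ^ 3 / 24"
    unfolding T_def using n0 by (simp add: power_divide power_mult_distrib)
  have "T \<le> n\<^sup>2 / 10"
  proof (rule power2_le_imp_le)
    have "real d ^ 3 * n ^ 3 \<le> n / 5 * n ^ 3"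
      using nd n0 by (intro mult_right_mono) auto
    also have "\<dots> = n ^ 4 / 5" by (simp add: power_numeral_reduce)
    finally have "T\<^sup>2 \<le> n ^ 4 / 120" unfolding T2 by (simp add: mult.commute)
    also have "\<dots> \<le> (n\<^sup>2 / 10)\<^sup>2" using n0 by (simp add: power_divide)
    finally show "T\<^sup>2 \<le> (n\<^sup>2 / 10)\<^sup>2" .
  qed simp
  then have Sn: "S < n\<^sup>2 / 10" using ST by simp
  \<comment> \<open>The largest \<open>m\<close> with \<open>2 * m + 2 \<le> d\<close>.\<close>
  define m where "m = d div 2 - 1"
  have m: "2 * m + 2 \<le> d" "m > 0" "d \<le> 2 * m + 3" using d unfolding m_def by linarith+
  then have m_ge: "real m \<ge> (real d - 3) / 2" by simp
  have "S < n\<^sup>2" using Sn zero_le_power2[of n] by linarith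
  moreover have "V \<noteq> {}" using n0 n_def by auto
  ultimately have "n * (n - S / n)\<^sup>2 * (real m * (real m + 1)\<^sup>2 / 2) \<le> S\<^sup>2"
    by (intro metric_deficit_sq_ge[OF fin _ fd sym tri inter m(1,2) S_def n_def])
  moreover have "n * (9 / 10 * n)\<^sup>2 * (real d ^ 3 / 18) \<le> n * (n - S / n)\<^sup>2 * (real m * (real m + 1)\<^sup>2 / 2)"
  proof (intro mult_mono mult_left_mono power_mono)
    show "9 / 10 * n \<le> n - S / n" using Sn n0 by (simp add: field_simps power2_eq_square)
    \<comment> \<open>For \<open>d \<ge> 100\<close> the bound \<open>(d - 3) / 2\<close> on
      \<open>m\<close> is at least 97 percent of \<open>d / 2\<close>, and
      \<open>0.97^3 / 16 > 1 / 18\<close>.\<close>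
    have "real d ^ 3 / 18 \<le> ((97 / 100) * real d / 2) ^ 3 / 2"
      by (simp add: power_mult_distrib power_divide)
    also have "\<dots> \<le> real m ^ 3 / 2"
      using m_ge d by (intro divide_right_mono power_mono) auto
    also have "\<dots> \<le> real m * (real m + 1)\<^sup>2 / 2"
      by (simp add: power_numeral_reduce algebra_simps)
    finally show "real d ^ 3 / 18 \<le> real m * (real m + 1)\<^sup>2 / 2" .
  qed (use n0 in auto)
  moreover have "S\<^sup>2 < T\<^sup>2" using ST S0 by (intro power_strict_mono) auto
  ultimately have "n * (9 / 10 * n)\<^sup>2 * (real d ^ 3 / 18) < real d ^ 3 * n ^ 3 / 24"
    unfolding T2 by linarith
  \<comment> \<open>The constant on the left is \<open>(9/10)^2 / 18 = 9/200\<close>, which is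
    larger than \<open>1/24\<close>.\<close>
  then have "(real d ^ 3 * n ^ 3) * (9 / 200) < (real d ^ 3 * n ^ 3) * (1 / 24)"
    by (simp add: power_numeral_reduce algebra_simps)
  moreover have "real d ^ 3 * n ^ 3 > 0" using n0 d by simp
  ultimately show False by linarith
qed

lemma wiener_deficit_ratio_ge:
  assumes d: "d \<ge> 100" and n: "real n \<ge> 5 * real d ^ 3" and ne: "wiener_values n d \<noteq> {}"
  shows "wiener_deficit_ratio n d \<ge> ereal (1 / (2 * sqrt 24))"
proof -
  have "max_wiener n d \<in> wiener_values n d"
    unfolding max_wiener_def by (rule Max_in[OF finite_wiener_values ne])
  then obtain G :: "nat pair_pre_digraph" where G: "pair_graph G" "card (pverts G) = n"
      "graph_diameter G = ereal (real d)" "max_wiener n d = wiener_index G"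
    unfolding wiener_values_def by blast
  interpret pair_graph G by fact
  obtain f where f: "\<And>u v. u \<in> pverts G \<Longrightarrow> v \<in> pverts G \<Longrightarrow> gdist G u v = ereal (real (f u v))"
    "\<And>u v. u \<in> pverts G \<Longrightarrow> v \<in> pverts G \<Longrightarrow> f u v \<le> d"
    "\<And>u. u \<in> pverts G \<Longrightarrow> f u u = 0"
    "\<And>u v. u \<in> pverts G \<Longrightarrow> v \<in> pverts G \<Longrightarrow> f u v = f v u"
    "\<And>u v w. u \<in> pverts G \<Longrightarrow> v \<in> pverts G \<Longrightarrow> w \<in> pverts G \<Longrightarrow> f u w \<le> f u v + f v w"
    "\<And>u v k. u \<in> pverts G \<Longrightarrow> v \<in> pverts G \<Longrightarrow> k \<le> f u v \<Longrightarrow>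
       \<exists>w\<in>pverts G. f u w = k \<and> f w v = f u v - k"
    by (rule finite_diameter_metric[OF G(1,3)], rule that)
  let ?W = "\<Sum>u\<in>pverts G. \<Sum>v\<in>pverts G. real (f u v)"
  have W: "max_wiener n d = ereal (?W / 2)"
    unfolding G(4) by (rule wiener_index_eq_half_sum) (use f pair_finite_verts in auto)
  have "sqrt (real d ^ 3) * sqrt (real n ^ 3) / sqrt 24
      \<le> (\<Sum>u\<in>pverts G. \<Sum>v\<in>pverts G. real d - real (f u v))"
    unfolding G(2)[symmetric]
    by (rule metric_deficit_ge[OF pair_finite_verts f(2,4-6) d]) (use n G(2) in auto)
  also have "\<dots> = real d * real n ^ 2 - ?W"
    by (simp add: sum_subtractf G(2) power2_eq_square)
  finally have S: "sqrt (real d ^ 3) * sqrt (real n ^ 3) / sqrt 24 \<le> real d * real n ^ 2 - ?W" .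
  have "n > 0" using n d by (intro gr0I) auto
  then have pos: "sqrt (real d ^ 3) * sqrt (real n ^ 3) > 0" using d by simp
  have "1 / (2 * sqrt 24) \<le> (real d / 2 * real n ^ 2 - ?W / 2) / (sqrt (real d ^ 3) * sqrt (real n ^ 3))"
    using S pos by (simp add: field_simps)
  moreover have "wiener_deficit_ratio n d
      = ereal ((real d / 2 * real n ^ 2 - ?W / 2) / (sqrt (real d ^ 3) * sqrt (real n ^ 3)))"
    unfolding wiener_deficit_ratio_def W using pos d \<open>n > 0\<close> by (simp add: powr_three_halves)
  ultimately show ?thesis by simp
qed

section \<open>The forked brush\<close>

text \<open>Number the points and join those with \<open>D\<close> equal to 1. Along an edge
  \<open>D\<close> changes by at most 1, so graph distance dominates \<open>D\<close>;
  \<open>conn\<close> bounds it by \<open>d\<close>, and the pair in \<open>far\<close> attains the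
  diameter. Only an inequality for the Wiener index results, since distinct points with
  \<open>D\<close> equal to 0 have positive graph distance.\<close>

lemma wiener_values_of_pseudometric:
  fixes D :: "'a \<Rightarrow> 'a \<Rightarrow> nat"
  assumes fin: "finite V"
    and refl: "\<And>x. x \<in> V \<Longrightarrow> D x x = 0"
    and sym: "\<And>x y. x \<in> V \<Longrightarrow> y \<in> V \<Longrightarrow> D x y = D y x"
    and tri: "\<And>x y z. x \<in> V \<Longrightarrow> y \<in> V \<Longrightarrow> z \<in> V \<Longrightarrow> D x z \<le> D x y + D y z"
    and conn: "\<And>x y. x \<in> V \<Longrightarrow> y \<in> V \<Longrightarrow>
       \<exists>k\<le>d. (x, y) \<in> {(a, b). a \<in> V \<and> b \<in> V \<and> D a b = 1} ^^ k"
    and far: "x0 \<in> V" "y0 \<in> V" "d \<le> D x0 y0"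
  shows "\<exists>w. ereal w \<in> wiener_values (card V) d \<and> (\<Sum>x\<in>V. \<Sum>y\<in>V. real (D x y)) / 2 \<le> w"
proof -
  define R where "R = {(a, b). a \<in> V \<and> b \<in> V \<and> D a b = 1}"
  obtain e where e: "bij_betw e {0..<card V} V" using ex_bij_betw_nat_finite[OF fin] by blast
  then have eV: "e u \<in> V" if "u < card V" for u using that by (auto dest: bij_betw_apply)
  have e_surj: "\<exists>u<card V. x = e u" if "x \<in> V" for x
    using that e by (metis atLeastLessThan_iff bij_betw_imp_surj_on imageE)
  define G :: "nat pair_pre_digraph" where
    "G = \<lparr>pverts = {0..<card V}, parcs = {(u, v). u < card V \<and> v < card V \<and> D (e u) (e v) = 1}\<rparr>"
  have [simp]: "pverts G = {0..<card V}" unfolding G_def by simp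
  have arcs: "(u, v) \<in> parcs G \<longleftrightarrow> u < card V \<and> v < card V \<and> D (e u) (e v) = 1" for u v
    unfolding G_def by simp
  have G: "pair_graph G"
  proof
    show "finite (parcs G)"
      by (rule finite_subset[of _ "{0..<card V} \<times> {0..<card V}"]) (auto simp: arcs)
    show "symmetric (with_proj G)"
      unfolding symmetric_def by (rule symI) (use eV sym arcs in auto)
  next
    fix a assume "a \<in> parcs G"
    then show "fst a \<noteq> snd a" using refl eV by (cases a) (auto simp: arcs)
  qed (auto simp: arcs)
  interpret pair_graph G by fact
  have walk_ge: "D (e u) (e v) \<le> length p" if "awalk u p v" for u p v
    using that
  proof (induction p arbitrary: u)
    case Nil
    then show ?case using refl eV by (auto simp: awalk_Nil_iff)
  next
    case (Cons a p)
    obtain w where a: "a = (u, w)" "(u, w) \<in> parcs G" "awalk w p v"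
      using Cons.prems by (cases a) (auto simp: awalk_Cons_iff)
    then have "v < card V" by auto
    then have "D (e u) (e v) \<le> D (e u) (e w) + D (e w) (e v)"
      using a by (intro tri) (auto simp: arcs eV)
    then show ?case using Cons.IH[OF a(3)] a by (auto simp: arcs)
  qed
  have gdist_ge: "ereal (real (D (e u) (e v))) \<le> gdist G u v" for u v
    unfolding gdist_eq[OF G] by (intro INF_greatest) (use walk_ge in auto)
  have walk: "\<exists>p. awalk u p v \<and> length p = k"
    if "(e u, e v) \<in> R ^^ k" "u < card V" "v < card V" for u v k
    using that
  proof (induction k arbitrary: u)
    case 0
    then have "u = v" using e by (auto simp: bij_betw_def inj_on_def)
    then show ?case using 0 by (intro exI[of _ "[]"]) (auto simp: awalk_Nil_iff)
  next
    case (Suc k)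
    obtain y where y: "(e u, y) \<in> R" "(y, e v) \<in> R ^^ k" using relpow_Suc_D2[OF Suc.prems(1)] by blast
    then obtain w where w: "w < card V" "y = e w" using e_surj unfolding R_def by blast
    then obtain p where "awalk w p v" "length p = k" using Suc.IH y Suc.prems by blast
    then show ?case using y w Suc.prems
      by (intro exI[of _ "(u, w) # p"]) (auto simp: awalk_Cons_iff arcs R_def)
  qed
  have gdist_le: "gdist G u v \<le> ereal (real d)" if uv: "u < card V" "v < card V" for u v
  proof -
    obtain k where k: "k \<le> d" "(e u, e v) \<in> R ^^ k" using conn[OF eV eV] uv unfolding R_def by blast
    then obtain p where "awalk u p v" "length p = k" using walk uv by blast
    then show ?thesis using gdist_le_awalk[OF G, of u p v] k
      by (meson ereal_less_eq(3) of_nat_le_iff order_trans)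
  qed
  have diam: "graph_diameter G = ereal (real d)"
  proof (rule antisym)
    show "graph_diameter G \<le> ereal (real d)"
      unfolding graph_diameter_def using gdist_le by (intro SUP_least) auto
    obtain u v where uv: "u < card V" "v < card V" "x0 = e u" "y0 = e v"
      using e_surj far by metis
    have "ereal (real d) \<le> ereal (real (D (e u) (e v)))" using far uv by simp
    also have "\<dots> \<le> gdist G u v" by (rule gdist_ge)
    also have "\<dots> \<le> graph_diameter G" using uv by (intro gdist_le_graph_diameter) auto
    finally show "ereal (real d) \<le> graph_diameter G" .
  qed
  obtain f where f: "\<And>u v. u \<in> pverts G \<Longrightarrow> v \<in> pverts G \<Longrightarrow> gdist G u v = ereal (real (f u v))"
    "\<And>u. u \<in> pverts G \<Longrightarrow> f u u = 0"
    "\<And>u v. u \<in> pverts G \<Longrightarrow> v \<in> pverts G \<Longrightarrow> f u v = f v u"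
    by (rule finite_diameter_metric[OF G diam], rule that)
  define w where "w = (\<Sum>u\<in>pverts G. \<Sum>v\<in>pverts G. real (f u v)) / 2"
  have "wiener_index G = ereal w"
    unfolding w_def by (rule wiener_index_eq_half_sum) (use f pair_finite_verts in auto)
  then have "ereal w \<in> wiener_values (card V) d"
    unfolding wiener_values_def using G diam by (intro CollectI exI[of _ G]) auto
  moreover have "(\<Sum>x\<in>V. \<Sum>y\<in>V. real (D x y))
      = (\<Sum>u\<in>pverts G. \<Sum>v\<in>pverts G. real (D (e u) (e v)))"
    unfolding sum.reindex_bij_betw[OF e, symmetric] by simp
  moreover have "\<dots> \<le> 2 * w"
    unfolding w_def using gdist_ge f(1)
    by simp (intro sum_mono, metis ereal_less_eq(3) of_nat_le_iff atLeastLessThan_iff)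
  ultimately show ?thesis by (intro exI[of _ w]) auto
qed

section \<open>Definition of the brush\<close>

type_synonym brush_vertex = "nat \<times> nat \<times> nat \<times> nat"

text \<open>
  A vertex \<open>(p, s, i, t)\<close> has depth \<open>i\<close> on branch \<open>p\<close>, which forks at depth \<open>b\<close> into the sub-branches
  \<open>s = 0\<close> and \<open>s = 1\<close>; up to the fork only \<open>s = 0\<close> is used. The copies with \<open>t > 0\<close> are twins of the end
  of a sub-branch. For even diameter (\<open>\<delta> = 0\<close>) all branches share the centre \<open>(0, 0, 0, 0)\<close>; for odd
  diameter (\<open>\<delta> = 1\<close>) their roots form a clique. Edges join vertices with \<open>brush_dist\<close> equal to 1, and
  \<open>brush_dist\<close> is only a pseudometric, since twins have distance 0.
\<close>

definition brush_dist :: "nat \<Rightarrow> nat \<Rightarrow> brush_vertex \<Rightarrow> brush_vertex \<Rightarrow> nat" where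
  "brush_dist \<delta> b = (\<lambda>(p, s, i, _) (q, s', j, _).
     if p \<noteq> q then i + j + \<delta>
     else if s \<noteq> s' \<and> b < i \<and> b < j then (i - b) + (j - b)
     else (i - j) + (j - i))"

definition brush_inner :: "nat \<Rightarrow> nat \<Rightarrow> nat \<Rightarrow> nat \<Rightarrow> brush_vertex set" where
  "brush_inner K h b \<delta> = {(p, s, i, t). p < K \<and> s < 2 \<and> i \<le> h \<and> t = 0 \<and>
     (i \<le> b \<longrightarrow> s = 0) \<and> (i = 0 \<and> \<delta> = 0 \<longrightarrow> p = 0)}"

text \<open>The residue of \<open>x\<close> modulo \<open>2 * K\<close> encodes one of the
  \<open>2 * K\<close> ends, its last bit being the sub-branch, so consecutive \<open>x\<close> are
  spread evenly. The last component \<open>Suc x\<close> keeps the copies distinct from each other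
  and from the inner vertices.\<close>

definition brush_leaf :: "nat \<Rightarrow> nat \<Rightarrow> nat \<Rightarrow> brush_vertex" where
  "brush_leaf K h x = (x mod (2 * K) div 2, x mod (2 * K) mod 2, h, Suc x)"

definition brush :: "nat \<Rightarrow> nat \<Rightarrow> nat \<Rightarrow> nat \<Rightarrow> nat \<Rightarrow> brush_vertex set" where
  "brush K h b \<delta> N = brush_inner K h b \<delta> \<union> brush_leaf K h ` {..<N}"

section \<open>Pseudometric axioms, size and connectedness of the brush\<close>

lemma brush_dist_refl: "brush_dist \<delta> b x x = 0"
  by (cases x) (auto simp: brush_dist_def)

lemma brush_dist_sym: "brush_dist \<delta> b x y = brush_dist \<delta> b y x"
  by (cases x; cases y) (auto simp: brush_dist_def)

lemma brush_dist_triangle: "brush_dist \<delta> b x z \<le> brush_dist \<delta> b x y + brush_dist \<delta> b y z"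
proof -
  obtain p s i t where x: "x = (p, s, i, t)" by (cases x)
  obtain p' s' i' t' where y: "y = (p', s', i', t')" by (cases y)
  obtain p'' s'' i'' t'' where z: "z = (p'', s'', i'', t'')" by (cases z)
  show ?thesis
  proof (cases "p = p' \<and> p' = p''")
    case True
    define D where "D s i s' j = (if s \<noteq> s' \<and> b < i \<and> b < j then (i - b) + (j - b) else (i - j) + (j - i))"
      for s i s' j :: nat
    \<comment> \<open>Within one branch the distance is never less than the difference in depth.
      This settles everything except end points beyond the fork on different sub-branches; there the
      middle point is at depth at most \<open>b\<close>, or it differs in sub-branch from one of the
      end points.\<close>
    have D_ge: "(i - j) + (j - i) \<le> D s i s' j" for s i s' j
      unfolding D_def by auto
    have "D s i s'' i'' \<le> D s i s' i' + D s' i' s'' i''"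
    proof (cases "s \<noteq> s'' \<and> b < i \<and> b < i''")
      case False
      then have "D s i s'' i'' = (i - i'') + (i'' - i)" by (auto simp: D_def)
      also have "\<dots> \<le> ((i - i') + (i' - i)) + ((i' - i'') + (i'' - i'))" by linarith
      finally show ?thesis using D_ge[of i i' s s'] D_ge[of i' i'' s' s''] by linarith
    next
      case T: True
      then have D: "D s i s'' i'' = (i - b) + (i'' - b)" by (auto simp: D_def)
      consider "i' \<le> b" | "b < i'" "s \<noteq> s'" | "b < i'" "s' \<noteq> s''" using T by fastforce
      then show ?thesis
      proof cases
        case 1
        then show ?thesis using D D_ge[of i i' s s'] D_ge[of i' i'' s' s''] by linarith
      next
        case 2
        then have "D s i s' i' = (i - b) + (i' - b)" using T by (auto simp: D_def)
        then show ?thesis using 2 D D_ge[of i' i'' s' s''] by linarith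
      next
        case 3
        then have "D s' i' s'' i'' = (i' - b) + (i'' - b)" using T by (auto simp: D_def)
        then show ?thesis using 3 D D_ge[of i i' s s'] by linarith
      qed
    qed
    with True show ?thesis unfolding x y z by (simp add: brush_dist_def D_def)
  next
    case False
    then show ?thesis unfolding x y z brush_dist_def by (cases "p = p''") auto
  qed
qed

lemma brush_inner_subset: "brush_inner K h b \<delta> \<subseteq> {..<K} \<times> {..<2} \<times> {..h} \<times> {0}"
  by (auto simp: brush_inner_def)

lemma finite_brush_inner: "finite (brush_inner K h b \<delta>)"
  by (rule finite_subset[OF brush_inner_subset]) simp

lemma card_brush_inner: "card (brush_inner K h b \<delta>) \<le> 2 * K * (h + 1)"
  using card_mono[OF _ brush_inner_subset, of K h b \<delta>] by (simp add: card_cartesian_product)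

lemma inj_brush_leaf: "inj_on (brush_leaf K h) X"
  by (auto simp: inj_on_def brush_leaf_def)

lemma brush_inner_disjoint_leaf: "brush_inner K h b \<delta> \<inter> brush_leaf K h ` X = {}"
  by (auto simp: brush_inner_def brush_leaf_def)

lemma card_brush: "card (brush K h b \<delta> N) = card (brush_inner K h b \<delta>) + N"
  unfolding brush_def
  by (subst card_Un_disjoint)
     (simp_all add: finite_brush_inner brush_inner_disjoint_leaf card_image inj_brush_leaf)

lemma relpow_sym:
  assumes "sym R" "(x, y) \<in> R ^^ k"
  shows "(y, x) \<in> R ^^ k"
  using assms(2)
proof (induction k arbitrary: y)
  case (Suc k)
  then obtain z where "(x, z) \<in> R ^^ k" "(z, y) \<in> R" by auto
  then show ?case using Suc.IH symD[OF assms(1)] by (meson relpow_Suc_I2)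
qed simp

definition brush_adj :: "nat \<Rightarrow> nat \<Rightarrow> nat \<Rightarrow> nat \<Rightarrow> nat \<Rightarrow> brush_vertex rel" where
  "brush_adj K h b \<delta> N =
    {(x, y). x \<in> brush K h b \<delta> N \<and> y \<in> brush K h b \<delta> N \<and> brush_dist \<delta> b x y = 1}"

lemma brush_walk_top:
  assumes "(p, s, i, t) \<in> brush K h b \<delta> N" "K > 0" "h > 0"
  shows "\<exists>q. (q, 0, 0, 0) \<in> brush_inner K h b \<delta> \<and>
    ((p, s, i, t), (q, 0, 0, 0)) \<in> brush_adj K h b \<delta> N ^^ i"
  using assms(1)
proof (induction i arbitrary: p s t)
  case 0
  then have "(p, s, 0, t) = (p, 0, 0, 0)" "(p, 0, 0, 0) \<in> brush_inner K h b \<delta>"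
    using assms(3) by (auto simp: brush_def brush_inner_def brush_leaf_def)
  then show ?case by (intro exI[of _ p]) auto
next
  case (Suc i)
  \<comment> \<open>The parent of the current vertex, in canonical form: at the fork or nearer the
    root the sub-branch is reset to 0, and a shared centre is represented by branch 0.\<close>
  define u where "u = (if i = 0 \<and> \<delta> = 0 then 0 else p, if i \<le> b then 0 else s, i, 0::nat)"
  have "x mod (2 * K) div 2 < K" for x
    by (rule less_mult_imp_div_less) (use assms(2) in \<open>simp add: mult.commute[of K]\<close>)
  then have "p < K" "s < 2" "Suc i \<le> h"
    using Suc.prems by (auto simp: brush_def brush_inner_def brush_leaf_def)
  then have u: "u \<in> brush K h b \<delta> N"
    using assms(2) by (auto simp: brush_def brush_inner_def u_def)
  then obtain q where q: "(q, 0, 0, 0) \<in> brush_inner K h b \<delta>"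
    "(u, (q, 0, 0, 0)) \<in> brush_adj K h b \<delta> N ^^ i"
    using Suc.IH unfolding u_def by blast
  have "brush_dist \<delta> b (p, s, Suc i, t) u = 1"
    by (auto simp: u_def brush_dist_def)
  then have "((p, s, Suc i, t), u) \<in> brush_adj K h b \<delta> N"
    using u Suc.prems by (auto simp: brush_adj_def)
  then show ?case using q by (meson relpow_Suc_I2)
qed

text \<open>Descend in depth from both points to their roots, one edge per level, and cross between
  the roots with at most \<open>\<delta>\<close> edges.\<close>

lemma brush_connected:
  assumes "x \<in> brush K h b \<delta> N" "y \<in> brush K h b \<delta> N" "K > 0" "h > 0" "\<delta> \<le> 1"
  shows "\<exists>k\<le>2 * h + \<delta>. (x, y) \<in> brush_adj K h b \<delta> N ^^ k"
proof -
  have sym: "sym (brush_adj K h b \<delta> N)"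
    by (rule symI) (auto simp: brush_adj_def brush_dist_sym)
  obtain p s i t where x: "x = (p, s, i, t)" by (cases x)
  obtain p' s' i' t' where y: "y = (p', s', i', t')" by (cases y)
  have ih: "i \<le> h" "i' \<le> h"
    using assms x y by (auto simp: brush_def brush_inner_def brush_leaf_def)
  obtain q where q: "(q, 0, 0, 0) \<in> brush_inner K h b \<delta>"
    "(x, (q, 0, 0, 0)) \<in> brush_adj K h b \<delta> N ^^ i"
    using brush_walk_top assms x by blast
  obtain q' where q': "(q', 0, 0, 0) \<in> brush_inner K h b \<delta>"
    "(y, (q', 0, 0, 0)) \<in> brush_adj K h b \<delta> N ^^ i'"
    using brush_walk_top assms y by blast
  have "\<exists>k\<le>\<delta>. ((q, 0, 0, 0), (q', 0, 0, 0)) \<in> brush_adj K h b \<delta> N ^^ k"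
  proof (cases "q = q'")
    case True
    then show ?thesis by (intro exI[of _ 0]) auto
  next
    case False
    \<comment> \<open>For \<open>\<delta> = 0\<close> the only root is the centre, so distinct roots
      occur only in the clique of the odd case.\<close>
    then have "\<delta> = 1" using q q' assms(5) by (auto simp: brush_inner_def)
    then show ?thesis using q q' False
      by (intro exI[of _ 1]) (auto simp: brush_adj_def brush_def brush_dist_def)
  qed
  then obtain k where k: "k \<le> \<delta>" "((q, 0, 0, 0), (q', 0, 0, 0)) \<in> brush_adj K h b \<delta> N ^^ k" by blast
  have "(x, y) \<in> brush_adj K h b \<delta> N ^^ (i + k + i')"
    using q(2) k(2) relpow_sym[OF sym q'(2)] by (auto simp: relpow_add)
  then show ?thesis using ih k by (intro exI[of _ "i + k + i'"]) auto
qed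

lemma brush_wiener_values:
  assumes "K \<ge> 2" "h > 0" "b < h" "\<delta> \<le> 1" "V = brush K h b \<delta> N" "d = 2 * h + \<delta>"
  shows "\<exists>w. ereal w \<in> wiener_values (card V) d \<and>
    (\<Sum>x\<in>V. \<Sum>y\<in>V. real (brush_dist \<delta> b x y)) / 2 \<le> w"
proof (rule wiener_values_of_pseudometric)
  show "finite V" unfolding assms(5) brush_def by (simp add: finite_brush_inner)
  show "(0, 0, h, 0) \<in> V" "(1, 0, h, 0) \<in> V" "d \<le> brush_dist \<delta> b (0, 0, h, 0) (1, 0, h, 0)"
    using assms by (auto simp: brush_def brush_inner_def brush_dist_def)
next
  fix x y assume "x \<in> V" "y \<in> V"
  then show "\<exists>k\<le>d. (x, y) \<in> {(a, b'). a \<in> V \<and> b' \<in> V \<and> brush_dist \<delta> b a b' = 1} ^^ k"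
    using brush_connected[of x K h b \<delta> N y] assms unfolding brush_adj_def by auto
next
  fix x y z
  show "brush_dist \<delta> b x x = 0" "brush_dist \<delta> b x y = brush_dist \<delta> b y x"
    "brush_dist \<delta> b x z \<le> brush_dist \<delta> b x y + brush_dist \<delta> b y z"
    by (fact brush_dist_refl brush_dist_sym brush_dist_triangle)+
qed

section \<open>Deficit of the brush\<close>

lemma card_mod_eq_le:
  fixes m c N :: nat
  assumes "m > 0"
  shows "card {x \<in> {..<N}. x mod m = c} \<le> N div m + 1"
proof -
  have "inj_on (\<lambda>x. x div m) {x \<in> {..<N}. x mod m = c}"
    by (rule inj_onI) (metis (mono_tags, lifting) div_mult_mod_eq mem_Collect_eq)
  moreover have "(\<lambda>x. x div m) ` {x \<in> {..<N}. x mod m = c} \<subseteq> {..N div m}"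
    by (auto intro: div_le_mono)
  ultimately have "card {x \<in> {..<N}. x mod m = c} \<le> card {..N div m}"
    by (intro card_inj_on_le) auto
  then show ?thesis by simp
qed

text \<open>Only two residue classes have positive deficit: twins at the same end, contributing
  \<open>2 * h + \<delta>\<close> each, and copies at the sibling end, contributing
  \<open>\<delta> + 2 * b\<close> each because their distance is \<open>2 * (h - b)\<close>. Each
  class has at most \<open>N / (2 * K) + 1\<close> members.\<close>

lemma brush_leaf_deficit:
  assumes "K > 0" "b < h"
  shows "(\<Sum>y<N. real (2 * h + \<delta>) - real (brush_dist \<delta> b (brush_leaf K h x) (brush_leaf K h y)))
    \<le> (real N / (2 * real K) + 1) * (2 * real h + 2 * \<delta> + 2 * real b)"
proof -
  define c where "c = x mod (2 * K)"
  \<comment> \<open>The residue of the sibling end: the same branch with the last bit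
    flipped.\<close>
  define c' where "c' = 2 * (c div 2) + (1 - c mod 2)"
  let ?A = "\<lambda>a. {y \<in> {..<N}. y mod (2 * K) = a}"
  have "real (2 * h + \<delta>) - real (brush_dist \<delta> b (brush_leaf K h x) (brush_leaf K h y))
      \<le> (if y mod (2 * K) = c then 2 * real h + \<delta> else 0)
        + (if y mod (2 * K) = c' then \<delta> + 2 * real b else 0)" for y
  proof -
    define e where "e = y mod (2 * K)"
    have e_eq: "e = 2 * (e div 2) + e mod 2" by simp
    have "e mod 2 = 1 - c mod 2" if "e mod 2 \<noteq> c mod 2"
      using that by (simp add: mod2_eq_if split: if_splits)
    with e_eq have *: "e = c'" if "e div 2 = c div 2" "e mod 2 \<noteq> c mod 2"
      unfolding c'_def using that by metis
    have D: "brush_dist \<delta> b (brush_leaf K h x) (brush_leaf K h y)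
        = (if c div 2 \<noteq> e div 2 then 2 * h + \<delta> else if c mod 2 \<noteq> e mod 2 then 2 * (h - b) else 0)"
      unfolding brush_dist_def brush_leaf_def c_def[symmetric] e_def[symmetric]
      using assms by (simp add: mult_2)
    consider "c div 2 \<noteq> e div 2" | "e = c" | "c div 2 = e div 2" "c mod 2 \<noteq> e mod 2" "e = c'"
      using * by (metis div_mult_mod_eq)
    then show ?thesis
    proof cases
      case 1
      then have "brush_dist \<delta> b (brush_leaf K h x) (brush_leaf K h y) = 2 * h + \<delta>"
        unfolding D by (simp only: if_True not_False_eq_True)
      then show ?thesis by simp
    next
      case 2
      then have "(if y mod (2 * K) = c then 2 * real h + \<delta> else 0) = 2 * real h + \<delta>"
        unfolding e_def by (simp only: if_True simp_thms)
      then show ?thesis by simp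
    next
      case 3
      then have "brush_dist \<delta> b (brush_leaf K h x) (brush_leaf K h y) = 2 * (h - b)"
        unfolding D by (simp only: if_True if_False simp_thms not_False_eq_True not_True_eq_False)
      moreover have "(if y mod (2 * K) = c' then \<delta> + 2 * real b else 0) = \<delta> + 2 * real b"
        using 3 unfolding e_def by (simp only: if_True simp_thms)
      ultimately show ?thesis using assms(2) by (simp add: of_nat_diff)
    qed
  qed
  then have "(\<Sum>y<N. real (2 * h + \<delta>) - real (brush_dist \<delta> b (brush_leaf K h x) (brush_leaf K h y)))
      \<le> (\<Sum>y<N. (if y mod (2 * K) = c then 2 * real h + \<delta> else 0)
        + (if y mod (2 * K) = c' then \<delta> + 2 * real b else 0))"
    by (rule sum_mono)
  also have "\<dots> = real (card (?A c)) * (2 * real h + \<delta>) + real (card (?A c')) * (\<delta> + 2 * real b)"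
    by (simp add: sum.distrib sum.If_cases Int_def)
  also have "\<dots> \<le> (real N / (2 * real K) + 1) * (2 * real h + \<delta>) 
      + (real N / (2 * real K) + 1) * (\<delta> + 2 * real b)"
  proof -
    have "real (card (?A a)) \<le> real N / (2 * real K) + 1" for a
    proof -
      have "real (card (?A a)) \<le> real (N div (2 * K)) + 1"
        using card_mod_eq_le[of "2 * K" N a] assms by linarith
      also have "real (N div (2 * K)) \<le> real N / real (2 * K)" by (rule of_nat_div_le_of_nat)
      finally show ?thesis by simp
    qed
    then show ?thesis by (intro add_mono mult_right_mono) auto
  qed
  also have "\<dots> = (real N / (2 * real K) + 1) * (2 * real h + 2 * \<delta> + 2 * real b)"
    unfolding distrib_left[symmetric] by simp
  finally show ?thesis .
qed

text \<open>In terms of \<open>j = h - i\<close> the weight is 2 exactly when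
  \<open>j < h - b\<close>, so the sum is the sum of \<open>j\<close> over \<open>j \<le> h\<close>
  plus a second one over \<open>j < h - b\<close>.\<close>

lemma sum_depth_deficit:
  assumes "b < h"
  shows "(\<Sum>i\<le>h. (real h - real i) * (if i \<le> b then 1 else 2))
    = (real h * (real h + 1) + (real h - real b) * (real h - real b - 1)) / 2"
proof -
  have gauss: "(\<Sum>j<m. real j) = real m * (real m - 1) / 2" for m
    by (induction m) (auto simp: field_simps)
  have "(\<Sum>i\<le>h. (real h - real i) * (if i \<le> b then 1 else 2))
      = (\<Sum>i<Suc h. (\<lambda>j. real j * (if j < h - b then 2 else 1)) (Suc h - Suc i))"
    unfolding lessThan_Suc_atMost by (rule sum.cong) (use assms in \<open>auto simp: of_nat_diff\<close>)
  also have "\<dots> = (\<Sum>j<Suc h. real j * (if j < h - b then 2 else 1))"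
    by (rule sum.nat_diff_reindex)
  also have "\<dots> = (\<Sum>j<Suc h. real j + (if j < h - b then real j else 0))"
    by (rule sum.cong) auto
  also have "\<dots> = (\<Sum>j<Suc h. real j) + (\<Sum>j<h - b. real j)"
  proof -
    have "{..<Suc h} \<inter> {j. j < h - b} = {..<h - b}" by auto
    then show ?thesis by (simp only: sum.distrib sum.If_cases finite_lessThan) simp
  qed
  also have "\<dots> = (real h * (real h + 1) + (real h - real b) * (real h - real b - 1)) / 2"
    unfolding gauss using assms by (simp add: of_nat_diff field_simps)
  finally show ?thesis .
qed

text \<open>On a branch other than that of the leaf, the deficit at depth \<open>i\<close> is
  exactly \<open>h - i\<close>. The leaf's own branch has at most \<open>2 * (h + 1)\<close> inner
  vertices, each charged the full diameter as an additional cost, which is of lower order because it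
  is not multiplied by \<open>K\<close>.\<close>

lemma brush_inner_leaf_deficit:
  assumes "K > 0" "b < h"
  shows "(\<Sum>y\<in>brush_inner K h b \<delta>. real (2 * h + \<delta>) - real (brush_dist \<delta> b (brush_leaf K h x) y))
    \<le> real K * ((real h * (real h + 1) + (real h - real b) * (real h - real b - 1)) / 2)
      + 2 * (real h + 1) * real (2 * h + \<delta>)"
proof -
  \<comment> \<open>\<open>Q\<close> gives every branch its own root even when the centre is shared,
    so that the sum factors over branches.\<close>
  define Q where "Q = (\<lambda>(p, i, s). (p, s, i, 0::nat)) `
    ({..<K} \<times> (SIGMA i:{..h}. if i \<le> b then {0} else {..<2::nat}))"
  let ?pc = "fst (brush_leaf K h x)"
  define g :: "brush_vertex \<Rightarrow> real" where "g = (\<lambda>(p, s, i, t). (real h - real i) + (if p = ?pc then real (2 * h + \<delta>) else 0) :: real)"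
  have sub: "brush_inner K h b \<delta> \<subseteq> Q" unfolding Q_def brush_inner_def
    by (auto simp: image_iff split: if_splits)
  have inj: "inj_on (\<lambda>(p, i, s). (p, s, i, 0::nat)) X" for X :: "(nat \<times> nat \<times> nat) set"
    by (auto simp: inj_on_def)
  have "(\<Sum>y\<in>brush_inner K h b \<delta>. real (2 * h + \<delta>) - real (brush_dist \<delta> b (brush_leaf K h x) y))
      \<le> (\<Sum>y\<in>brush_inner K h b \<delta>. g y)"
  proof (rule sum_mono)
    fix y assume y: "y \<in> brush_inner K h b \<delta>"
    obtain p s i t where yy: "y = (p, s, i, t)" by (cases y)
    show "real (2 * h + \<delta>) - real (brush_dist \<delta> b (brush_leaf K h x) y) \<le> g y"
    proof (cases "p = ?pc")
      case True
      then have "g y = real h - real i + real (2 * h + \<delta>)" by (simp add: g_def yy)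
      moreover have "i \<le> h" using y by (simp add: yy brush_inner_def)
      ultimately show ?thesis by simp
    next
      case False
      then have "brush_dist \<delta> b (brush_leaf K h x) y = h + i + \<delta>"
        by (auto simp: yy brush_dist_def brush_leaf_def)
      moreover have "g y = real h - real i" using False by (simp add: g_def yy)
      ultimately show ?thesis by simp
    qed
  qed
  also have "\<dots> \<le> (\<Sum>y\<in>Q. g y)"
    by (rule sum_mono2) (use sub in \<open>auto simp: Q_def g_def\<close>)
  also have "\<dots> = (\<Sum>(p, i, s)\<in>{..<K} \<times> (SIGMA i:{..h}. if i \<le> b then {0} else {..<2::nat}). g (p, s, i, 0))"
    unfolding Q_def by (subst sum.reindex[OF inj]) (simp add: case_prod_unfold)
  also have "\<dots> = (\<Sum>p<K. \<Sum>i\<le>h. \<Sum>s\<in>(if i \<le> b then {0} else {..<2::nat}). g (p, s, i, 0))"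
    unfolding sum.cartesian_product[symmetric]
    by (rule sum.cong[OF refl], rule sum.Sigma[symmetric]) auto
  also have "\<dots> = (\<Sum>p<K. (\<Sum>i\<le>h. (real h - real i) * (if i \<le> b then 1 else 2))
      + (if p = ?pc then \<Sum>i\<le>h. (if i \<le> b then 1 else 2) * real (2 * h + \<delta>) else 0))"
    by (rule sum.cong[OF refl]) (auto simp: g_def sum.distrib[symmetric] intro!: sum.cong)
  also have "\<dots> = real K * (\<Sum>i\<le>h. (real h - real i) * (if i \<le> b then 1 else 2))
      + (\<Sum>p<K. if p = ?pc then \<Sum>i\<le>h. (if i \<le> b then 1 else 2) * real (2 * h + \<delta>) else 0)"
    by (simp add: sum.distrib)
  also have "(\<Sum>p<K. if p = ?pc then \<Sum>i\<le>h. (if i \<le> b then 1 else 2) * real (2 * h + \<delta>) else 0)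
      \<le> 2 * (real h + 1) * real (2 * h + \<delta>)"
  proof -
    have "(\<Sum>i\<le>h. (if i \<le> b then 1 else 2) * real (2 * h + \<delta>)) \<le> (\<Sum>i\<le>h. 2 * real (2 * h + \<delta>))"
      by (rule sum_mono) auto
    also have "\<dots> = 2 * (real h + 1) * real (2 * h + \<delta>)" by (simp add: algebra_simps)
    finally show ?thesis by (simp add: sum.delta)
  qed
  finally show ?thesis unfolding sum_depth_deficit[OF assms(2)] by simp
qed

text \<open>Ordered pairs split into inner-inner, inner-leaf counted twice, and leaf-leaf. The first
  kind is estimated crudely by the diameter: for \<open>K\<close> of order \<open>sqrt n\<close> it
  contributes only a multiple of \<open>n\<close>.\<close>

lemma brush_deficit:
  assumes "K > 0" "b < h" "d = 2 * h + \<delta>" "V = brush K h b \<delta> N"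
  shows "(\<Sum>x\<in>V. \<Sum>y\<in>V. real d - real (brush_dist \<delta> b x y))
    \<le> (2 * real K * (real h + 1))\<^sup>2 * real d
      + 2 * real N * (real K * ((real h * (real h + 1) + (real h - real b) * (real h - real b - 1)) / 2)
          + 2 * (real h + 1) * real d)
      + real N * (real N / (2 * real K) + 1) * (2 * real h + 2 * \<delta> + 2 * real b)"
proof -
  let ?P = "brush_inner K h b \<delta>" and ?l = "brush_leaf K h"
  define D where "D x y = real d - real (brush_dist \<delta> b x y)" for x y
  have Dsym: "D x y = D y x" for x y unfolding D_def by (simp add: brush_dist_sym)
  have split: "(\<Sum>x\<in>V. g x) = (\<Sum>x\<in>?P. g x) + (\<Sum>x<N. g (?l x))" for g :: "brush_vertex \<Rightarrow> real"
    unfolding assms(4) brush_def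
    by (subst sum.union_disjoint)
       (simp_all add: finite_brush_inner brush_inner_disjoint_leaf sum.reindex inj_brush_leaf)
  have PP: "(\<Sum>x\<in>?P. \<Sum>y\<in>?P. D x y) \<le> (2 * real K * (real h + 1))\<^sup>2 * real d"
  proof -
    have "(\<Sum>x\<in>?P. \<Sum>y\<in>?P. D x y) \<le> (\<Sum>x\<in>?P. \<Sum>y\<in>?P. real d)"
      by (intro sum_mono) (simp add: D_def)
    also have "\<dots> = (real (card ?P))\<^sup>2 * real d" by (simp add: power2_eq_square)
    also have "\<dots> \<le> (2 * real K * (real h + 1))\<^sup>2 * real d"
    proof (intro mult_right_mono power_mono)
      have "real (card ?P) \<le> real (2 * K * (h + 1))"
        using card_brush_inner by (simp only: of_nat_le_iff)
      then show "real (card ?P) \<le> 2 * real K * (real h + 1)" by (simp add: algebra_simps)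
    qed auto
    finally show ?thesis .
  qed
  define B where "B = real K * ((real h * (real h + 1) + (real h - real b) * (real h - real b - 1)) / 2)
          + 2 * (real h + 1) * real d"
  have LP: "(\<Sum>y\<in>?P. D (?l x) y) \<le> B" for x
    unfolding B_def D_def using brush_inner_leaf_deficit[OF assms(1,2)] assms(3) by simp
  have LL: "(\<Sum>y<N. D (?l x) (?l y)) \<le> (real N / (2 * real K) + 1) * (2 * real h + 2 * \<delta> + 2 * real b)" for x
    unfolding D_def using brush_leaf_deficit[OF assms(1,2)] assms(3) by simp
  have "(\<Sum>x\<in>V. \<Sum>y\<in>V. D x y)
      = (\<Sum>x\<in>?P. \<Sum>y\<in>?P. D x y) + (\<Sum>x\<in>?P. \<Sum>y<N. D x (?l y))
        + ((\<Sum>x<N. \<Sum>y\<in>?P. D (?l x) y) + (\<Sum>x<N. \<Sum>y<N. D (?l x) (?l y)))"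
    by (simp add: split sum.distrib)
  also have "(\<Sum>x\<in>?P. \<Sum>y<N. D x (?l y)) = (\<Sum>x<N. \<Sum>y\<in>?P. D (?l x) y)"
    by (subst sum.swap) (simp add: Dsym)
  also have "(\<Sum>x\<in>?P. \<Sum>y\<in>?P. D x y) + (\<Sum>x<N. \<Sum>y\<in>?P. D (?l x) y)
        + ((\<Sum>x<N. \<Sum>y\<in>?P. D (?l x) y) + (\<Sum>x<N. \<Sum>y<N. D (?l x) (?l y)))
      \<le> (2 * real K * (real h + 1))\<^sup>2 * real d + (\<Sum>x<N. B)
        + ((\<Sum>x<N. B) + (\<Sum>x<N. (real N / (2 * real K) + 1) * (2 * real h + 2 * \<delta> + 2 * real b)))"
    by (intro add_mono PP sum_mono LP LL)
  finally show ?thesis unfolding D_def B_def[symmetric] by (simp add: algebra_simps)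
qed

text \<open>With the fork at two thirds of the height, \<open>h - b\<close> is about
  \<open>h / 3\<close>, so the depth sum is about
  \<open>(h\<^sup>2 + h\<^sup>2 / 9) / 2 = 5 * d\<^sup>2 / 36\<close>, and the leaf factor
  \<open>2 * h + 2 * b\<close> is about \<open>5 * d / 3\<close>. The remaining terms absorb
  rounding and parity.\<close>

lemma brush_exists:
  assumes d: "d \<ge> 2" and K: "K \<ge> 2" and n: "K * (d + 2) \<le> n"
  shows "\<exists>w. ereal w \<in> wiener_values n d \<and>
    real d * real n ^ 2 - 2 * w \<le> 4 * (real K)\<^sup>2 * real d ^ 3
      + 2 * real n * (real K * (5 * (real d)\<^sup>2 / 36 + real d / 3) + 2 * (real d)\<^sup>2)
      + real n * (real n / (2 * real K) + 1) * (5 * real d / 3 + 1)"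
proof -
  define h \<delta> b where "h = d div 2" and "\<delta> = d mod 2" and "b = 2 * h div 3"
  have hd: "d = 2 * h + \<delta>" "\<delta> \<le> 1" "h > 0" using d unfolding h_def \<delta>_def by auto
  have b: "b < h" "3 * b \<le> 2 * h" "2 * h \<le> 3 * b + 2" using hd unfolding b_def by linarith+
  \<comment> \<open>The hypothesis \<open>K * (d + 2) \<le> n\<close> ensures that this subtraction
    is not truncated, so the brush has exactly \<open>n\<close> vertices.\<close>
  define N where "N = n - card (brush_inner K h b \<delta>)"
  define V where "V = brush K h b \<delta> N"
  have "card (brush_inner K h b \<delta>) \<le> K * (2 * h + 2)"
    using card_brush_inner[of K h b \<delta>] by (simp add: algebra_simps)
  also have "\<dots> \<le> K * (d + 2)" using hd by (intro mult_left_mono) auto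
  finally have cV: "card V = n" unfolding V_def card_brush N_def using n by simp
  have Nn: "N \<le> n" unfolding N_def by simp
  obtain w where w: "ereal w \<in> wiener_values n d"
    "(\<Sum>x\<in>V. \<Sum>y\<in>V. real (brush_dist \<delta> b x y)) / 2 \<le> w"
    using brush_wiener_values[OF K hd(3) b(1) hd(2) V_def hd(1)] cV by auto
  have dr: "real d = 2 * real h + real \<delta>" using hd(1) by simp
  define B where "B = (real h * (real h + 1) + (real h - real b) * (real h - real b - 1)) / 2"
  have "real d * real n ^ 2 - 2 * w \<le> (\<Sum>x\<in>V. \<Sum>y\<in>V. real d - real (brush_dist \<delta> b x y))"
    using w(2) by (simp add: sum_subtractf cV power2_eq_square)
  also have "\<dots> \<le> (2 * real K * (real h + 1))\<^sup>2 * real d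
      + 2 * real N * (real K * B + 2 * (real h + 1) * real d)
      + real N * (real N / (2 * real K) + 1) * (2 * real h + 2 * \<delta> + 2 * real b)"
    unfolding B_def by (rule brush_deficit[OF _ b(1) hd(1) V_def]) (use K in simp)
  also have "\<dots> \<le> (2 * real K * real d)\<^sup>2 * real d
      + 2 * real n * (real K * (5 * (real d)\<^sup>2 / 36 + real d / 3) + 2 * real d * real d)
      + real n * (real n / (2 * real K) + 1) * (5 * real d / 3 + 1)"
  proof -
    have h1: "real h + 1 \<le> real d" using hd by simp
    have bh: "real b \<le> real d / 3" using b dr by simp
    have last: "2 * real h + 2 * real \<delta> + 2 * real b \<le> 5 * real d / 3 + 1" using bh dr hd(2) by linarith
    have rb: "2 * real h \<le> 3 * real b + 2" "real b + 1 \<le> real h" using b by linarith+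
    \<comment> \<open>Rounding down loses at most \<open>2 / 3\<close> in \<open>b\<close>, whence
      \<open>h - b \<le> (h + 2) / 3\<close>.\<close>
    have "(real h - real b) * (real h - real b - 1) \<le> ((real h + 2) / 3) * ((real h - 1) / 3)"
      using rb by (intro mult_mono) auto
    then have "B \<le> 5 * ((real h)\<^sup>2 + real h) / 9"
      unfolding B_def by (simp add: field_simps power2_eq_square)
    also have "\<dots> \<le> 5 * ((real d / 2)\<^sup>2 + real d / 2) / 9"
      using dr by (intro divide_right_mono mult_left_mono add_mono power_mono) auto
    also have "\<dots> \<le> 5 * (real d)\<^sup>2 / 36 + real d / 3" by (simp add: power_divide field_simps)
    finally have B: "B \<le> 5 * (real d)\<^sup>2 / 36 + real d / 3" .
    have B0: "B \<ge> 0" unfolding B_def using rb by simp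
    show ?thesis
    proof (intro add_mono)
      show "(2 * real K * (real h + 1))\<^sup>2 * real d \<le> (2 * real K * real d)\<^sup>2 * real d"
        using h1 by (intro mult_right_mono power_mono mult_left_mono) auto
      show "2 * real N * (real K * B + 2 * (real h + 1) * real d)
          \<le> 2 * real n * (real K * (5 * (real d)\<^sup>2 / 36 + real d / 3) + 2 * real d * real d)"
        using Nn h1 B B0 by (intro mult_mono add_mono mult_left_mono mult_right_mono) auto
      show "real N * (real N / (2 * real K) + 1) * (2 * real h + 2 * \<delta> + 2 * real b)
          \<le> real n * (real n / (2 * real K) + 1) * (5 * real d / 3 + 1)"
      proof (rule mult_mono)
        show "2 * real h + 2 * \<delta> + 2 * real b \<le> 5 * real d / 3 + 1" using last by simp
        show "real N * (real N / (2 * real K) + 1) \<le> real n * (real n / (2 * real K) + 1)"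
          using Nn by (intro mult_mono add_mono divide_right_mono) auto
      qed auto
    qed
  qed
  finally show ?thesis using w(1)
    by (intro exI[of _ w]) (simp add: power2_eq_square power3_eq_cube algebra_simps)
qed

lemma wiener_deficit_ratio_le:
  assumes "ereal w \<in> wiener_values n d" "d > 0" "n > 0"
    and "real d * real n ^ 2 - 2 * w \<le> u"
  shows "wiener_deficit_ratio n d \<le> ereal (u / (2 * (sqrt (real d ^ 3) * sqrt (real n ^ 3))))"
proof -
  define s where "s = sqrt (real d ^ 3) * sqrt (real n ^ 3)"
  have s: "s > 0" unfolding s_def using assms by simp
  have "ereal w \<le> max_wiener n d"
    unfolding max_wiener_def by (rule Max_ge[OF finite_wiener_values assms(1)])
  then have "ereal (real d / 2 * real n ^ 2) - max_wiener n d \<le> ereal (real d / 2 * real n ^ 2) - ereal w"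
    by (rule ereal_minus_mono[OF order_refl])
  then have "wiener_deficit_ratio n d \<le> (ereal (real d / 2 * real n ^ 2) - ereal w) / ereal s"
    unfolding wiener_deficit_ratio_def s_def using s s_def
    by (simp only: powr_three_halves of_nat_0_le_iff) (intro ereal_divide_right_mono, auto)
  also have "\<dots> = ereal ((real d / 2 * real n ^ 2 - w) / s)" using s by simp
  also have "\<dots> \<le> ereal (u / 2 / s)"
    unfolding ereal_less_eq by (rule divide_right_mono) (use assms(4) s in auto)
  finally show ?thesis unfolding s_def by simp
qed

section \<open>Asymptotics\<close>

text \<open>Here \<open>c * sqrt n\<close> is the intended number of branches and the added 1 allows
  for rounding up. Only the terms of order \<open>n^(3/2)\<close> survive:
  \<open>2 * c * \<beta>\<close> from inner-leaf pairs and \<open>\<gamma> / (2 * c)\<close> from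
  leaf-leaf pairs.\<close>

lemma brush_bound_tendsto:
  fixes c s D E \<beta> \<gamma> :: real
  assumes "c > 0" "s > 0" "D > 0" "E > 0" "\<beta> > 0" "\<gamma> > 0"
  shows "(\<lambda>n::nat. (4 * (c * sqrt n + 1)\<^sup>2 * D + 2 * real n * ((c * sqrt n + 1) * \<beta> + E)
      + real n * (real n / (2 * (c * sqrt n)) + 1) * \<gamma>) / (2 * (s * sqrt (real n ^ 3))))
    \<longlonglongrightarrow> (2 * c * \<beta> + \<gamma> / (2 * c)) / (2 * s)"
  using assms by real_asymp (simp add: field_simps)

text \<open>Besides the upper bound this provides that some graph of order \<open>n\<close> and
  diameter \<open>d\<close> exists, which the lower bound needs for the maximum to be
  attained.\<close>

lemma wiener_deficit_ratio_eventually_le: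
  assumes d: "d \<ge> 1000"
  shows "\<forall>\<^sub>F n in sequentially. wiener_values n d \<noteq> {} \<and> wiener_deficit_ratio n d \<le> ereal (482 / 1000)"
proof -
  \<comment> \<open>The limit \<open>2 * c * \<beta> + \<gamma> / (2 * c)\<close> is least at
    \<open>c\<^sup>2 = \<gamma> / (4 * \<beta>)\<close>, which is \<open>3 / d\<close> for the
    leading terms \<open>5 * d\<^sup>2 / 36\<close> and \<open>5 * d / 3\<close>.\<close>
  define c s where "c = sqrt (3 / real d)" and "s = sqrt (real d ^ 3)"
  define \<beta> \<gamma> where "\<beta> = 5 * (real d)\<^sup>2 / 36 + real d / 3" and "\<gamma> = 5 * real d / 3 + 1"
  define U where "U n = (4 * (c * sqrt n + 1)\<^sup>2 * real d ^ 3
      + 2 * real n * ((c * sqrt n + 1) * \<beta> + 2 * (real d)\<^sup>2)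
      + real n * (real n / (2 * (c * sqrt n)) + 1) * \<gamma>) / (2 * (s * sqrt (real n ^ 3)))" for n :: nat
  have d0: "real d > 0" using d by simp
  have pos: "c > 0" "s > 0" "\<beta> > 0" "\<gamma> > 0" unfolding c_def s_def \<beta>_def \<gamma>_def using d0
    by (auto intro!: add_pos_pos)
  have "U \<longlonglongrightarrow> (2 * c * \<beta> + \<gamma> / (2 * c)) / (2 * s)"
    unfolding U_def using pos d0 by (intro brush_bound_tendsto) auto
  moreover have "(2 * c * \<beta> + \<gamma> / (2 * c)) / (2 * s) < 482 / 1000"
  proof -
    have c2: "c\<^sup>2 = 3 / real d" and s2: "s\<^sup>2 = real d ^ 3" unfolding c_def s_def by simp_all
    have "c * (real d)\<^sup>2 = sqrt 3 * s"
    proof (rule power2_eq_imp_eq)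
      show "(c * (real d)\<^sup>2)\<^sup>2 = (sqrt 3 * s)\<^sup>2"
        unfolding power_mult_distrib c2 s2 using d0 by (simp add: power_numeral_reduce)
    qed (use pos in auto)
    then have cs: "c = sqrt 3 * s / (real d)\<^sup>2" using d0 by (simp add: field_simps)
    have "c / s = sqrt 3 / (real d)\<^sup>2" using cs pos by simp
    moreover have "1 / (c * s) = sqrt 3 / (3 * real d)"
      unfolding cs using d0 s2 pos by (simp add: field_simps power2_eq_square power3_eq_cube)
    moreover have "(2 * c * \<beta> + \<gamma> / (2 * c)) / (2 * s) = c / s * \<beta> + 1 / (c * s) * \<gamma> / 4"
      using pos by (simp add: field_simps)
    ultimately have "(2 * c * \<beta> + \<gamma> / (2 * c)) / (2 * s)
        = sqrt 3 / (real d)\<^sup>2 * \<beta> + sqrt 3 / (3 * real d) * \<gamma> / 4" by (simp only:)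
    \<comment> \<open>Both costs contribute \<open>5 / 36\<close>, balanced as expected at the
      optimum; the rest vanishes as \<open>d\<close> grows and is small enough once
      \<open>d \<ge> 1000\<close>.\<close>
    also have "\<dots> = sqrt 3 * (10 / 36 + 5 / (12 * real d))"
      unfolding \<beta>_def \<gamma>_def using d0 by (simp add: field_simps power2_eq_square)
    also have "\<dots> \<le> 17321 / 10000 * (2782 / 10000)"
    proof (intro mult_mono)
      show "sqrt 3 \<le> 17321 / 10000" by (rule real_le_lsqrt) (auto simp: power2_eq_square)
      show "10 / 36 + 5 / (12 * real d) \<le> 2782 / 10000" using d by (simp add: field_simps)
    qed auto
    also have "\<dots> < 482 / 1000" by simp
    finally show ?thesis .
  qed
  ultimately have ev1: "\<forall>\<^sub>F n in sequentially. U n < 482 / 1000" by (rule order_tendstoD(2))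
  have ev2: "\<forall>\<^sub>F n in sequentially. (c * sqrt (real n) + 1) * (real d + 2) \<le> real n"
    using pos d0 by real_asymp
  have ev3: "\<forall>\<^sub>F n in sequentially. c * sqrt (real n) > 1"
    using pos by real_asymp
  show ?thesis
    using ev1 ev2 ev3 eventually_gt_at_top[of 0]
  proof eventually_elim
    case (elim n)
    define r where "r = c * sqrt (real n)"
    define K where "K = nat \<lceil>r\<rceil>"
    have r1: "r > 1" using elim(3) unfolding r_def .
    have Kr: "r \<le> real K" "real K \<le> r + 1" unfolding K_def using r1 by linarith+
    have K2: "K \<ge> 2" using Kr r1 by linarith
    have "real K * (real d + 2) \<le> (r + 1) * (real d + 2)"
      using Kr by (intro mult_right_mono) auto
    also have "\<dots> \<le> real n" using elim(2) unfolding r_def .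
    finally have "real (K * (d + 2)) \<le> real n" by (simp add: algebra_simps)
    then have Kn: "K * (d + 2) \<le> n" by (simp only: of_nat_le_iff)
    obtain w where w: "ereal w \<in> wiener_values n d"
      "real d * real n ^ 2 - 2 * w \<le> 4 * (real K)\<^sup>2 * real d ^ 3
      + 2 * real n * (real K * \<beta> + 2 * (real d)\<^sup>2)
      + real n * (real n / (2 * real K) + 1) * \<gamma>"
      using brush_exists[OF _ K2 Kn] d unfolding \<beta>_def \<gamma>_def by auto
    have "real d * real n ^ 2 - 2 * w \<le> 4 * (r + 1)\<^sup>2 * real d ^ 3
      + 2 * real n * ((r + 1) * \<beta> + 2 * (real d)\<^sup>2)
      + real n * (real n / (2 * r) + 1) * \<gamma>"
      \<comment> \<open>Since \<open>r \<le> K \<le> r + 1\<close>, \<open>K\<close> is replaced by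
        \<open>r + 1\<close> where the bound increases in it and by \<open>r\<close> in the
        denominator.\<close>
      by (rule order_trans[OF w(2)], intro add_mono mult_mono power_mono divide_left_mono)
         (use Kr r1 pos in auto)
    then have "wiener_deficit_ratio n d \<le> ereal (U n)"
      unfolding U_def r_def[symmetric] s_def
      by (intro wiener_deficit_ratio_le[OF w(1)]) (use d elim(4) in auto)
    also have "\<dots> \<le> ereal (482 / 1000)" using elim(1) by simp
    finally show ?case using w(1) by auto
  qed
qed

theorem theorem3p4:
  shows "liminf (\<lambda>d. liminf (\<lambda>n. wiener_deficit_ratio n d)) \<ge> ereal (1 / (2 * sqrt 24))
    \<and> 1 / (2 * sqrt 24) > (0.1 :: real)
    \<and> limsup (\<lambda>d. limsup (\<lambda>n. wiener_deficit_ratio n d)) < ereal (29 / 60)"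
proof (intro conjI)
  \<comment> \<open>The threshold 1000 comes from the brush, which supplies the nonemptiness of
    \<open>wiener_values n d\<close>; the estimate itself holds from 100 on.\<close>
  have "ereal (1 / (2 * sqrt 24)) \<le> liminf (\<lambda>n. wiener_deficit_ratio n d)" if d: "d \<ge> 1000" for d
  proof (rule Liminf_bounded)
    have "\<forall>\<^sub>F n in sequentially. real n \<ge> 5 * real d ^ 3" by real_asymp
    with wiener_deficit_ratio_eventually_le[OF d]
    show "\<forall>\<^sub>F n in sequentially. ereal (1 / (2 * sqrt 24)) \<le> wiener_deficit_ratio n d"
    proof eventually_elim
      case (elim n)
      then show ?case using wiener_deficit_ratio_ge[of d n] d by simp
    qed
  qed
  then show "ereal (1 / (2 * sqrt 24)) \<le> liminf (\<lambda>d. liminf (\<lambda>n. wiener_deficit_ratio n d))"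
    by (rule Liminf_bounded[OF eventually_sequentiallyI[of 1000]])
  have "sqrt 24 < 5" by (rule real_less_lsqrt) auto
  then show "1 / (2 * sqrt 24) > (0.1 :: real)" by (simp add: field_simps)
  have "limsup (\<lambda>n. wiener_deficit_ratio n d) \<le> ereal (482 / 1000)" if d: "d \<ge> 1000" for d
    by (rule Limsup_bounded, rule eventually_mono[OF wiener_deficit_ratio_eventually_le[OF d]]) auto
  then have "limsup (\<lambda>d. limsup (\<lambda>n. wiener_deficit_ratio n d)) \<le> ereal (482 / 1000)"
    by (rule Limsup_bounded[OF eventually_sequentiallyI[of 1000]])
  also have "\<dots> < ereal (29 / 60)" by simp
  finally show "limsup (\<lambda>d. limsup (\<lambda>n. wiener_deficit_ratio n d)) < ereal (29 / 60)" .
qed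

end
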